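(* Let $X$ be a Hausdorff paracompact space and let $n>1$ be an integer. Then $C(X)$ is approximately $n$-th root closed if and only if the group $H^1(A;\mathbb{Z})$ is $n$-divisible for every closed subset $A$ of $X$.
   Context: $C(X)$ denotes the algebra of all bounded continuous complex-valued functions on $X$ with the supremum norm $\|\cdot\|$. $C(X)$ is called approximately $n$-th root closed if for every $f\in C(X)$ and every $\varepsilon>0$ there exists $g\in C(X)$ with $\|f-g^n\|<\varepsilon$. $H^1(A;\mathbb{Z})$ denotes the first Čech cohomology group with integer coefficients; for a Hausdorff paracompact space $A$ it is canonically isomorphic (Huber's theorem) to the group $[A,S^1]$ of homotopy classes of continuous maps $A\to S^1=\{z\in\mathbb{C}:|z|=1\}$, with group operation induced by pointwise multiplication. An abelian group $G$ is $n$-divisible if for every $a\in G$ there is $b\in G$ with $nb=a$. *)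

theory Defs
  imports "HOL-Analysis.Analysis" "HOL-Algebra.Product_Groups"
begin

definition open_cover :: "'a topology \<Rightarrow> 'a set set \<Rightarrow> bool" where
  "open_cover X \<U> \<longleftrightarrow> (\<forall>U\<in>\<U>. openin X U) \<and> \<Union>\<U> = topspace X"

definition refines :: "'a set set \<Rightarrow> 'a set set \<Rightarrow> bool" where
  "refines \<V> \<U> \<longleftrightarrow> (\<forall>V\<in>\<V>. \<exists>U\<in>\<U>. V \<subseteq> U)"

definition paracompact_space :: "'a topology \<Rightarrow> bool" where
  "paracompact_space X \<longleftrightarrow>
     (\<forall>\<U>. open_cover X \<U> \<longrightarrow> (\<exists>\<V>. open_cover X \<V> \<and> refines \<V> \<U> \<and> locally_finite_in X \<V>))"


text \<open>Elements of \<open>C(X)\<close> are represented by total functions on the underlying type; only their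
  values on \<^term>\<open>topspace X\<close> matter.\<close>

definition bounded_continuous_functions :: "'a topology \<Rightarrow> ('a \<Rightarrow> complex) set" where
  "bounded_continuous_functions X =
     {f. continuous_map X euclidean f \<and> bounded (f ` topspace X)}"

text \<open>The inserted 0 is only relevant for the empty space, on which every function has norm 0
  (the supremum of the empty set of reals is unspecified).\<close>

definition sup_norm :: "'a topology \<Rightarrow> ('a \<Rightarrow> complex) \<Rightarrow> real" where
  "sup_norm X f = Sup (insert 0 ((\<lambda>x. norm (f x)) ` topspace X))"

definition approximately_root_closed :: "nat \<Rightarrow> 'a topology \<Rightarrow> bool" where
  "approximately_root_closed n X \<longleftrightarrow>
     (\<forall>f\<in>bounded_continuous_functions X. \<forall>\<epsilon>>0.
        \<exists>g\<in>bounded_continuous_functions X. sup_norm X (\<lambda>x. f x - g x ^ n) < \<epsilon>)"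

definition divisible_by :: "nat \<Rightarrow> ('g, 'm) monoid_scheme \<Rightarrow> bool" where
  "divisible_by n G \<longleftrightarrow> (\<forall>a\<in>carrier G. \<exists>b\<in>carrier G. b [^]\<^bsub>G\<^esub> n = a)"


text \<open>The direct limit of groups \<open>G i\<close> over an index set \<open>I\<close> directed by \<open>leq\<close>, with transition
  homomorphisms \<open>f i j : G i \<rightarrow> G j\<close> for \<open>leq i j\<close>. Its elements are the classes of pairs
  \<open>(i, x)\<close>, where \<open>x\<close> is in \<open>G i\<close>, two pairs being identified if they have the same image at some
  later index. The unions in the group structure are over all choices of representatives and of a
  common upper index; for a direct system all the classes united are equal.\<close>

definition direct_limit_rel ::
  "'i set \<Rightarrow> ('i \<Rightarrow> 'i \<Rightarrow> bool) \<Rightarrow> ('i \<Rightarrow> ('g, 'm) monoid_scheme) \<Rightarrow> ('i \<Rightarrow> 'i \<Rightarrow> 'g \<Rightarrow> 'g)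
     \<Rightarrow> (('i \<times> 'g) \<times> ('i \<times> 'g)) set" where
  "direct_limit_rel I leq G f =
     {((i, x), (j, y)). i \<in> I \<and> x \<in> carrier (G i) \<and> j \<in> I \<and> y \<in> carrier (G j) \<and>
        (\<exists>k\<in>I. leq i k \<and> leq j k \<and> f i k x = f j k y)}"

definition direct_limit ::
  "'i set \<Rightarrow> ('i \<Rightarrow> 'i \<Rightarrow> bool) \<Rightarrow> ('i \<Rightarrow> ('g, 'm) monoid_scheme) \<Rightarrow> ('i \<Rightarrow> 'i \<Rightarrow> 'g \<Rightarrow> 'g)
     \<Rightarrow> ('i \<times> 'g) set monoid" where
  "direct_limit I leq G f =
     \<lparr>carrier = (SIGMA i:I. carrier (G i)) // direct_limit_rel I leq G f,
      monoid.mult = (\<lambda>P Q. \<Union>(i, x)\<in>P. \<Union>(j, y)\<in>Q. \<Union>k\<in>{k \<in> I. leq i k \<and> leq j k}.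
         direct_limit_rel I leq G f `` {(k, f i k x \<otimes>\<^bsub>G k\<^esub> f j k y)}),
      one = (\<Union>i\<in>I. direct_limit_rel I leq G f `` {(i, \<one>\<^bsub>G i\<^esub>)})\<rparr>"


text \<open>Ordered simplices of the nerve of \<open>\<U>\<close>: vertices may be repeated. The cochains are all
  integer-valued functions on these, not only the alternating ones, which yields the same
  cohomology.\<close>

definition nerve :: "'a set set \<Rightarrow> nat \<Rightarrow> 'a set list set" where
  "nerve \<U> q = {s. length s = Suc q \<and> set s \<subseteq> \<U> \<and> \<Inter>(set s) \<noteq> {}}"

definition cochain_group :: "'a set set \<Rightarrow> nat \<Rightarrow> ('a set list \<Rightarrow> int) monoid" where
  "cochain_group \<U> q = product_group (nerve \<U> q) (\<lambda>_. integer_group)"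

definition coboundary :: "'a set set \<Rightarrow> nat \<Rightarrow> ('a set list \<Rightarrow> int) \<Rightarrow> 'a set list \<Rightarrow> int" where
  "coboundary \<U> q c =
     (\<lambda>s\<in>nerve \<U> (Suc q). \<Sum>i\<le>Suc q. (- 1) ^ i * c (take i s @ drop (Suc i) s))"

definition cocycles :: "'a set set \<Rightarrow> nat \<Rightarrow> ('a set list \<Rightarrow> int) set" where
  "cocycles \<U> q = kernel (cochain_group \<U> q) (cochain_group \<U> (Suc q)) (coboundary \<U> q)"

fun coboundaries :: "'a set set \<Rightarrow> nat \<Rightarrow> ('a set list \<Rightarrow> int) set" where
  "coboundaries \<U> 0 = {\<one>\<^bsub>cochain_group \<U> 0\<^esub>}"
| "coboundaries \<U> (Suc q) = coboundary \<U> q ` carrier (cochain_group \<U> q)"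

definition cover_cohomology :: "'a set set \<Rightarrow> nat \<Rightarrow> ('a set list \<Rightarrow> int) set monoid" where
  "cover_cohomology \<U> q =
     (cochain_group \<U> q)\<lparr>carrier := cocycles \<U> q\<rparr> Mod coboundaries \<U> q"

text \<open>A refinement \<open>\<V>\<close> of \<open>\<U>\<close> induces a map from the cohomology of \<open>\<U>\<close> to that of \<open>\<V>\<close>, by pulling
  cocycles back along a map \<open>\<rho>\<close> with \<open>V \<subseteq> \<rho> V \<in> \<U>\<close>. The class obtained does not depend on \<open>\<rho>\<close> or
  on the representing cocycle, so the union below is over equal cosets.\<close>

definition refinement_maps :: "'a set set \<Rightarrow> 'a set set \<Rightarrow> ('a set \<Rightarrow> 'a set) set" where
  "refinement_maps \<U> \<V> = {\<rho>. \<forall>V\<in>\<V>. \<rho> V \<in> \<U> \<and> V \<subseteq> \<rho> V}"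

definition cochain_pullback ::
  "'a set set \<Rightarrow> nat \<Rightarrow> ('a set \<Rightarrow> 'a set) \<Rightarrow> ('a set list \<Rightarrow> int) \<Rightarrow> 'a set list \<Rightarrow> int" where
  "cochain_pullback \<V> q \<rho> c = (\<lambda>s\<in>nerve \<V> q. c (map \<rho> s))"

definition cohomology_refinement ::
  "nat \<Rightarrow> 'a set set \<Rightarrow> 'a set set \<Rightarrow> ('a set list \<Rightarrow> int) set \<Rightarrow> ('a set list \<Rightarrow> int) set" where
  "cohomology_refinement q \<U> \<V> h =
     (\<Union>c\<in>h. \<Union>\<rho>\<in>refinement_maps \<U> \<V>.
        coboundaries \<V> q #>\<^bsub>cochain_group \<V> q\<^esub> cochain_pullback \<V> q \<rho> c)"

text \<open>The \<open>q\<close>-th Cech cohomology group of \<open>X\<close> with integer coefficients, written multiplicatively as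
  all groups of \<^theory>\<open>HOL-Algebra.Group\<close>. Covers are sets of open sets rather than indexed
  families; as every indexed cover and its range refine each other, the limit is the same.\<close>

definition cech_cohomology :: "nat \<Rightarrow> 'a topology \<Rightarrow> ('a set set \<times> ('a set list \<Rightarrow> int) set) set monoid"
  where
  "cech_cohomology q X =
     direct_limit {\<U>. open_cover X \<U>} (\<lambda>\<U> \<V>. refines \<V> \<U>)
       (\<lambda>\<U>. cover_cohomology \<U> q) (cohomology_refinement q)"

end

(* The bridge between the two conditions is the existence of continuous n-th roots of circle-valued
   functions on closed subsets.

   If the root condition holds for C(X), extend f : A -> S^1 to F on X by Tietze; for an approximate
   root g of F the quotient g^n / f lies in the right half plane on A, so its logarithm corrects g
   to an exact root of f. Conversely, take an exact root of f / |f| on {|f| >= eps/4}, extend it by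
   Tietze, push it radially into the unit disc and multiply it by |f|^(1/n).

   Divisibility of the direct limit H^1(A; Z) says that every integer 1-cocycle c becomes n times a
   cocycle modulo coboundaries after refinement. A partition of unity writes c as the coboundary of
   real functions h, and f = exp(2 pi i h) is a well-defined circle-valued function; the sheets of
   an n-th root of f refine the cover and divide c by n. Conversely, the jumps of local logarithms
   of f form a cocycle, and dividing it by n glues the n-th roots of the local branches. *)

theory Submission
  imports Defs "HOL-Library.Real_Mod"
begin

section \<open>Paracompact Hausdorff spaces\<close>

text \<open>Zeros are the obstacle. A function has no direction \<open>f / |f|\<close> at its zeros,
  and a Tietze extension of a circle-valued function from \<open>A\<close> may vanish off
  \<open>A\<close>, so exact roots in C(X) cannot be expected. Approximation takes the zeros out of
  play: where \<open>|f|\<close> is small, every \<open>g\<close> with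
  \<open>|g|^n \<le> |f|\<close> is close enough, and only the closed set where \<open>|f|\<close>
  is bounded below carries an obstruction. This is why closed subsets enter, and not only
  \<open>X\<close>. The isomorphism of H^1(A; Z) with [A, S^1] is not built. Divisibility only asks
  whether one equation can be solved, so an integer cocycle is compared directly with a
  circle-valued function whose logarithms jump by it. Paracompactness enters through normality,
  which gives Tietze extensions on \<open>X\<close>, and through bump functions on each closed
  \<open>A\<close>, by which integer cocycles are realised by functions.\<close>

lemma refinesD: "\<lbrakk>refines \<V> \<U>; V \<in> \<V>\<rbrakk> \<Longrightarrow> \<exists>U\<in>\<U>. V \<subseteq> U"
  by (simp add: refines_def)

text \<open>Closure commutes with unions of locally finite families, so neighbourhoods avoiding
  \<open>P\<close> around the points of \<open>C\<close> combine to one around all of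
  \<open>C\<close>. With \<open>P\<close> a point this turns Hausdorff separation into regularity;
  with \<open>P\<close> closed it turns regularity into normality.\<close>

lemma paracompact_space_separation:
  assumes X: "paracompact_space X" and C: "closedin X C"
    and sep: "\<And>y. y \<in> C \<Longrightarrow> \<exists>U. openin X U \<and> y \<in> U \<and> disjnt P (X closure_of U)"
  shows "\<exists>W. openin X W \<and> C \<subseteq> W \<and> disjnt P (X closure_of W)"
proof -
  define \<U> where "\<U> = insert (topspace X - C) {U. openin X U \<and> disjnt P (X closure_of U)}"
  have "open_cover X \<U>"
    unfolding open_cover_def
  proof (intro conjI ballI subset_antisym)
    show "topspace X \<subseteq> \<Union>\<U>"
    proof
      fix x assume x: "x \<in> topspace X"
      show "x \<in> \<Union>\<U>"
      proof (cases "x \<in> C")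
        case True
        then obtain U where "openin X U" "x \<in> U" "disjnt P (X closure_of U)"
          using sep by metis
        then show ?thesis
          unfolding \<U>_def by (intro UnionI[of U]) auto
      qed (use x in \<open>simp add: \<U>_def\<close>)
    qed
    show "openin X U" if "U \<in> \<U>" for U
      using that C unfolding \<U>_def by auto
    then show "\<Union>\<U> \<subseteq> topspace X"
      using openin_subset by blast
  qed
  then obtain \<V> where V: "open_cover X \<V>" "refines \<V> \<U>" "locally_finite_in X \<V>"
    using X unfolding paracompact_space_def by blast
  \<comment> \<open>A member that meets \<open>C\<close> cannot lie in the complement of
    \<open>C\<close>, so it lies in some \<open>U\<close> whose closure avoids
    \<open>P\<close>.\<close>
  define \<V>' where "\<V>' = {V \<in> \<V>. V \<inter> C \<noteq> {}}"
  have disj: "disjnt P (X closure_of V)" if V': "V \<in> \<V>'" for V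
  proof -
    obtain U where U: "U \<in> \<U>" "V \<subseteq> U"
      using refinesD[OF V(2), of V] V' unfolding \<V>'_def by auto
    then have "U \<noteq> topspace X - C"
      using that unfolding \<V>'_def by blast
    then have "disjnt P (X closure_of U)"
      using U(1) unfolding \<U>_def by blast
    then show ?thesis
      by (rule disjnt_subset2[OF _ closure_of_mono[OF U(2)]])
  qed
  have "locally_finite_in X \<V>'"
    using V(3) by (rule locally_finite_in_subset) (simp add: \<V>'_def)
  then have "X closure_of \<Union>\<V>' = (\<Union>V\<in>\<V>'. X closure_of V)"
    by (rule closure_of_locally_finite_Union)
  then have "disjnt P (X closure_of \<Union>\<V>')"
    using disj by (simp add: disjnt_Union2)
  moreover have "openin X (\<Union>\<V>')"
    using V(1) by (intro openin_Union) (simp add: \<V>'_def open_cover_def)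
  moreover have "C \<subseteq> \<Union>\<V>'"
    using V(1) closedin_subset[OF C] unfolding \<V>'_def open_cover_def by blast
  ultimately show ?thesis by (intro exI conjI)
qed

lemma paracompact_Hausdorff_imp_regular_space:
  assumes "Hausdorff_space X" "paracompact_space X"
  shows "regular_space X"
  unfolding regular_space_def
proof (intro allI impI, elim conjE)
  fix C a assume C: "closedin X C" and a: "a \<in> topspace X - C"
  have "\<exists>U. openin X U \<and> y \<in> U \<and> disjnt {a} (X closure_of U)" if "y \<in> C" for y
  proof -
    have "y \<in> topspace X" "a \<in> topspace X" "y \<noteq> a"
      using that a closedin_subset[OF C] by auto
    then obtain U V where UV: "openin X U" "openin X V" "y \<in> U" "a \<in> V" "disjnt U V"
      using assms(1) unfolding Hausdorff_space_def by metis
    then have "V \<inter> X closure_of U = {}"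
      using openin_Int_closure_of_eq_empty[OF UV(2), of U] by (simp add: disjnt_def Int_commute)
    then show ?thesis
      using UV by (auto simp: disjnt_def)
  qed
  then obtain W where W: "openin X W" "C \<subseteq> W" "disjnt {a} (X closure_of W)"
    using paracompact_space_separation[OF assms(2) C] by metis
  have "disjnt (topspace X - X closure_of W) W"
    using closure_of_subset[OF openin_subset[OF W(1)]] by (auto simp: disjnt_def)
  moreover have "a \<in> topspace X - X closure_of W"
    using a W(3) by (simp add: disjnt_def)
  moreover have "openin X (topspace X - X closure_of W)"
    by (simp add: openin_diff)
  ultimately show "\<exists>U V. openin X U \<and> openin X V \<and> a \<in> U \<and> C \<subseteq> V \<and> disjnt U V"
    using W by blast
qed

lemma paracompact_Hausdorff_imp_normal_space:
  assumes "Hausdorff_space X" "paracompact_space X"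
  shows "normal_space X"
  unfolding normal_space
proof (intro allI impI, elim conjE)
  fix S T assume S: "closedin X S" and T: "closedin X T" and ST: "disjnt S T"
  have "\<exists>U. openin X U \<and> y \<in> U \<and> disjnt T (X closure_of U)" if "y \<in> S" for y
  proof -
    have "y \<in> topspace X - T"
      using that ST closedin_subset[OF S] by (auto simp: disjnt_def)
    then show ?thesis
      using paracompact_Hausdorff_imp_regular_space[OF assms] T unfolding regular_space by metis
  qed
  then show "\<exists>U. openin X U \<and> S \<subseteq> U \<and> disjnt T (X closure_of U)"
    by (rule paracompact_space_separation[OF assms(2) S])
qed

lemma paracompact_space_closed_subtopology:
  assumes X: "paracompact_space X" and A: "closedin X A"
  shows "paracompact_space (subtopology X A)"
  unfolding paracompact_space_def
proof (intro allI impI)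
  fix \<U> assume \<U>: "open_cover (subtopology X A) \<U>"
  define \<U>' where "\<U>' = insert (topspace X - A) {U. openin X U \<and> A \<inter> U \<in> \<U>}"
  have top: "topspace (subtopology X A) = A"
    using closedin_subset[OF A] by auto
  have "open_cover X \<U>'"
    unfolding open_cover_def
  proof (intro conjI ballI subset_antisym)
    show "topspace X \<subseteq> \<Union>\<U>'"
    proof
      fix x assume x: "x \<in> topspace X"
      show "x \<in> \<Union>\<U>'"
      proof (cases "x \<in> A")
        case True
        then obtain U where "U \<in> \<U>" "x \<in> U"
          using \<U> top unfolding open_cover_def by blast
        moreover from this obtain O' where "openin X O'" "U = A \<inter> O'"
          using \<U> unfolding open_cover_def openin_subtopology by (metis Int_commute)
        ultimately show ?thesis
          unfolding \<U>'_def by blast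
      qed (use x in \<open>auto simp: \<U>'_def\<close>)
    qed
    show "openin X U" if "U \<in> \<U>'" for U
      using that A unfolding \<U>'_def by auto
    then show "\<Union>\<U>' \<subseteq> topspace X"
      using openin_subset by blast
  qed
  then obtain \<V> where V: "open_cover X \<V>" "refines \<V> \<U>'" "locally_finite_in X \<V>"
    using X unfolding paracompact_space_def by blast
  \<comment> \<open>A refining set inside the complement of \<open>A\<close> has an empty trace and
    points to no member of \<open>\<U>\<close>; a set with nonempty trace lies in an open set
    extending such a member.\<close>
  define \<W> where "\<W> = (\<lambda>V. A \<inter> V) ` {V \<in> \<V>. A \<inter> V \<noteq> {}}"
  have "open_cover (subtopology X A) \<W>"
    unfolding open_cover_def
  proof (intro conjI ballI)
    show "\<Union>\<W> = topspace (subtopology X A)"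
      using V(1) closedin_subset[OF A] unfolding top \<W>_def open_cover_def by blast
    show "openin (subtopology X A) W" if "W \<in> \<W>" for W
      using that V(1) unfolding \<W>_def open_cover_def by (auto simp: openin_subtopology_Int2)
  qed
  moreover have "refines \<W> \<U>"
    unfolding refines_def
  proof
    fix W assume "W \<in> \<W>"
    then obtain V where V': "V \<in> \<V>" "A \<inter> V \<noteq> {}" "W = A \<inter> V"
      unfolding \<W>_def by blast
    then obtain U where "U \<in> \<U>'" "V \<subseteq> U"
      using V(2) unfolding refines_def by blast
    moreover from this have "A \<inter> U \<in> \<U>"
      using V'(2) unfolding \<U>'_def by blast
    ultimately show "\<exists>U\<in>\<U>. W \<subseteq> U"
      using V'(3) by (intro bexI[of _ "A \<inter> U"]) auto
  qed
  moreover have "locally_finite_in (subtopology X A) \<W>"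
  proof (rule locally_finite_in_subtopology)
    show "locally_finite_in X \<W>"
      unfolding \<W>_def
      by (intro locally_finite_in_refinement locally_finite_in_subset[OF V(3)]) auto
    show "\<Union>\<W> \<subseteq> A"
      unfolding \<W>_def by blast
  qed
  ultimately show "\<exists>\<V>. open_cover (subtopology X A) \<V> \<and> refines \<V> \<U> \<and> locally_finite_in (subtopology X A) \<V>"
    by blast
qed

section \<open>Locally finite sums and bump functions subordinate to a cover\<close>

lemma continuous_map_locally_finite_sum:
  fixes f :: "'a set \<Rightarrow> 'a \<Rightarrow> 'b::real_normed_vector"
  assumes lf: "locally_finite_in X \<V>"
    and cont: "\<And>A. A \<in> \<V> \<Longrightarrow> continuous_map X euclidean (f A)"
    and zero: "\<And>A x. \<lbrakk>A \<in> \<V>; x \<in> topspace X; x \<notin> A\<rbrakk> \<Longrightarrow> f A x = 0"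
  shows "continuous_map X euclidean (\<lambda>x. \<Sum>A | A \<in> \<V> \<and> x \<in> A. f A x)"
proof (rule pasting_lemma[where I = "{N. openin X N \<and> finite {A \<in> \<V>. A \<inter> N \<noteq> {}}}" and T = id
      and f = "\<lambda>N x. \<Sum>A | A \<in> \<V> \<and> A \<inter> N \<noteq> {}. f A x"])
  \<comment> \<open>The index set of the sum varies with \<open>x\<close>. On an open
    \<open>N\<close> meeting finitely many members it may be replaced by the fixed finite set of
    those meeting \<open>N\<close>, the added terms being 0.\<close>
  have eq: "(\<Sum>A | A \<in> \<V> \<and> A \<inter> N \<noteq> {}. f A x) = (\<Sum>A | A \<in> \<V> \<and> x \<in> A. f A x)"
    if "finite {A \<in> \<V>. A \<inter> N \<noteq> {}}" "x \<in> topspace X" "x \<in> N" for N x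
    by (rule sum.mono_neutral_right) (use that zero in auto)
  show "continuous_map (subtopology X (id N)) euclidean (\<lambda>x. \<Sum>A | A \<in> \<V> \<and> A \<inter> N \<noteq> {}. f A x)"
    if "N \<in> {N. openin X N \<and> finite {A \<in> \<V>. A \<inter> N \<noteq> {}}}" for N
    using that by (intro continuous_map_sum continuous_map_from_subtopology cont) auto
  show "(\<Sum>A | A \<in> \<V> \<and> A \<inter> M \<noteq> {}. f A x) = (\<Sum>A | A \<in> \<V> \<and> A \<inter> N \<noteq> {}. f A x)"
    if "M \<in> {N. openin X N \<and> finite {A \<in> \<V>. A \<inter> N \<noteq> {}}}"
      "N \<in> {N. openin X N \<and> finite {A \<in> \<V>. A \<inter> N \<noteq> {}}}" "x \<in> topspace X \<inter> id M \<inter> id N" for M N x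
    using that eq[of M x] eq[of N x] by simp
  show "\<exists>N. N \<in> {N. openin X N \<and> finite {A \<in> \<V>. A \<inter> N \<noteq> {}}} \<and> x \<in> id N \<and>
      (\<Sum>A | A \<in> \<V> \<and> x \<in> A. f A x) = (\<Sum>A | A \<in> \<V> \<and> A \<inter> N \<noteq> {}. f A x)"
    if x: "x \<in> topspace X" for x
  proof -
    obtain N where "openin X N" "x \<in> N" "finite {A \<in> \<V>. A \<inter> N \<noteq> {}}"
      using lf x unfolding locally_finite_in_def by blast
    then show ?thesis
      using eq[of N x] x by auto
  qed
qed simp

lemma locally_finite_in_finite_at:
  assumes "locally_finite_in X \<V>" "x \<in> topspace X"
  shows "finite {A \<in> \<V>. x \<in> A}"
proof -
  obtain N where "x \<in> N" "finite {A \<in> \<V>. A \<inter> N \<noteq> {}}"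
    using assms unfolding locally_finite_in_def by blast
  then show ?thesis
    by (elim rev_finite_subset) auto
qed

text \<open>The functions stay unnormalised; a quotient by their sum replaces the partition of unity
  later. Urysohn's lemma needs a closed set inside each \<open>A\<close>, and these closed sets must
  still cover \<open>X\<close>, so the cover is shrunk by a second refinement.\<close>

lemma paracompact_bump_functions:
  assumes X: "Hausdorff_space X" "paracompact_space X" and \<U>: "open_cover X \<U>"
  obtains \<V> \<psi> where "open_cover X \<V>" "refines \<V> \<U>" "locally_finite_in X \<V>"
    and "\<And>A. A \<in> \<V> \<Longrightarrow> continuous_map X euclideanreal (\<psi> A)"
    and "\<And>A x. \<lbrakk>A \<in> \<V>; x \<in> topspace X\<rbrakk> \<Longrightarrow> 0 \<le> \<psi> A x"
    and "\<And>A x. \<lbrakk>A \<in> \<V>; x \<in> topspace X; x \<notin> A\<rbrakk> \<Longrightarrow> \<psi> A x = 0"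
    and "\<And>x. x \<in> topspace X \<Longrightarrow> \<exists>A\<in>\<V>. 0 < \<psi> A x"
proof -
  obtain \<V> where V: "open_cover X \<V>" "refines \<V> \<U>" "locally_finite_in X \<V>"
    using X(2) \<U> unfolding paracompact_space_def by blast
  \<comment> \<open>By regularity, the open sets whose closure fits into a member of
    \<open>\<V>\<close> still cover \<open>X\<close>.\<close>
  define \<O> where "\<O> = {N. openin X N \<and> (\<exists>A\<in>\<V>. X closure_of N \<subseteq> A)}"
  have "open_cover X \<O>"
    unfolding open_cover_def
  proof (intro conjI ballI subset_antisym subsetI)
    fix x assume x: "x \<in> topspace X"
    then obtain A where A: "A \<in> \<V>" "x \<in> A"
      using V(1) unfolding open_cover_def by blast
    then have "closedin X (topspace X - A)" "x \<in> topspace X - (topspace X - A)"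
      using V(1) x unfolding open_cover_def by auto
    then obtain N where N: "openin X N" "x \<in> N" "disjnt (topspace X - A) (X closure_of N)"
      using paracompact_Hausdorff_imp_regular_space[OF X] unfolding regular_space by metis
    then have "X closure_of N \<subseteq> A"
      using closure_of_subset_topspace[of X N] by (auto simp: disjnt_def)
    then show "x \<in> \<Union>\<O>"
      using N A unfolding \<O>_def by blast
  next
    show "x \<in> topspace X" if "x \<in> \<Union>\<O>" for x
      using that openin_subset unfolding \<O>_def by blast
  qed (simp add: \<O>_def)
  then obtain \<W> where W: "open_cover X \<W>" "refines \<W> \<O>" "locally_finite_in X \<W>"
    using X(2) unfolding paracompact_space_def by blast
  have "\<exists>A. A \<in> \<V> \<and> X closure_of N \<subseteq> A" if N: "N \<in> \<W>" for N
  proof -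
    obtain M where "M \<in> \<O>" "N \<subseteq> M"
      using refinesD[OF W(2) N] by auto
    then show ?thesis
      using closure_of_mono[of N M X] unfolding \<O>_def by blast
  qed
  then obtain \<tau> where \<tau>: "\<And>N. N \<in> \<W> \<Longrightarrow> \<tau> N \<in> \<V> \<and> X closure_of N \<subseteq> \<tau> N"
    by metis
  \<comment> \<open>Collects the closures assigned to \<open>A\<close>; local finiteness of
    \<open>\<W>\<close> keeps the union closed.\<close>
  define F where "F A = \<Union>((\<lambda>N. X closure_of N) ` {N \<in> \<W>. \<tau> N = A})" for A
  have F_closed: "closedin X (F A)" for A
    unfolding F_def
    by (intro closedin_Union_locally_finite_closure locally_finite_in_subset[OF W(3)]) auto
  have F_sub: "F A \<subseteq> A" for A
    using \<tau> unfolding F_def by blast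
  have "\<exists>g. continuous_map X (top_of_set {0..1::real}) g \<and> g ` (topspace X - A) \<subseteq> {0} \<and> g ` F A \<subseteq> {1}"
    if "A \<in> \<V>" for A
  proof -
    have "closedin X (topspace X - A)"
      using that V(1) unfolding open_cover_def by auto
    moreover have "disjnt (topspace X - A) (F A)"
      using F_sub[of A] by (auto simp: disjnt_def)
    ultimately show ?thesis
      by (rule Urysohn_lemma[OF paracompact_Hausdorff_imp_normal_space[OF X] _ F_closed, of "topspace X - A" A 0 1])
        auto
  qed
  then obtain \<psi> where \<psi>: "\<And>A. A \<in> \<V> \<Longrightarrow> continuous_map X (top_of_set {0..1::real}) (\<psi> A) \<and>
      \<psi> A ` (topspace X - A) \<subseteq> {0} \<and> \<psi> A ` F A \<subseteq> {1}"
    by metis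
  show thesis
  proof (rule that[OF V, of \<psi>])
    show "continuous_map X euclideanreal (\<psi> A)" if "A \<in> \<V>" for A
      using \<psi>[OF that] continuous_map_into_fulltopology by blast
    show "0 \<le> \<psi> A x" if "A \<in> \<V>" "x \<in> topspace X" for A x
      using \<psi>[OF that(1)] that(2) unfolding continuous_map_in_subtopology by auto
    show "\<psi> A x = 0" if "A \<in> \<V>" "x \<in> topspace X" "x \<notin> A" for A x
      using \<psi>[OF that(1)] that by auto
    show "\<exists>A\<in>\<V>. 0 < \<psi> A x" if x: "x \<in> topspace X" for x
    proof -
      obtain N where N: "N \<in> \<W>" "x \<in> N"
        using x W(1) unfolding open_cover_def by blast
      then have "openin X N"
        using W(1) by (simp add: open_cover_def)
      then have "x \<in> X closure_of N"
        using closure_of_subset[OF openin_subset] N(2) by (metis subsetD)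
      then have "x \<in> F (\<tau> N)"
        unfolding F_def using N by blast
      then have "\<psi> (\<tau> N) x = 1"
        using \<psi>[of "\<tau> N"] \<tau>[OF N(1)] by blast
      then show ?thesis
        using \<tau>[OF N(1)] by (intro bexI[of _ "\<tau> N"]) auto
    qed
  qed
qed

section \<open>Divisibility in direct limits of groups\<close>

locale direct_system =
  fixes I :: "'i set" and leq :: "'i \<Rightarrow> 'i \<Rightarrow> bool"
    and G :: "'i \<Rightarrow> ('g, 'm) monoid_scheme" and f :: "'i \<Rightarrow> 'i \<Rightarrow> 'g \<Rightarrow> 'g"
  assumes nonempty: "I \<noteq> {}"
    and leq_refl: "i \<in> I \<Longrightarrow> leq i i"
    and leq_trans: "\<lbrakk>i \<in> I; j \<in> I; k \<in> I; leq i j; leq j k\<rbrakk> \<Longrightarrow> leq i k"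
    and directed: "\<lbrakk>i \<in> I; j \<in> I\<rbrakk> \<Longrightarrow> \<exists>k\<in>I. leq i k \<and> leq j k"
    and group: "i \<in> I \<Longrightarrow> group (G i)"
    and hom: "\<lbrakk>i \<in> I; j \<in> I; leq i j\<rbrakk> \<Longrightarrow> f i j \<in> hom (G i) (G j)"
    and compose: "\<lbrakk>i \<in> I; j \<in> I; k \<in> I; leq i j; leq j k; x \<in> carrier (G i)\<rbrakk>
      \<Longrightarrow> f j k (f i j x) = f i k x"
begin

abbreviation "rel \<equiv> direct_limit_rel I leq G f"
abbreviation "cls i x \<equiv> rel `` {(i, x)}"
abbreviation "L \<equiv> direct_limit I leq G f"

lemma closed: "\<lbrakk>i \<in> I; j \<in> I; leq i j; x \<in> carrier (G i)\<rbrakk> \<Longrightarrow> f i j x \<in> carrier (G j)"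
  using hom by (auto simp: hom_def)

lemma f_mult: "\<lbrakk>i \<in> I; j \<in> I; leq i j; x \<in> carrier (G i); y \<in> carrier (G i)\<rbrakk>
    \<Longrightarrow> f i j (x \<otimes>\<^bsub>G i\<^esub> y) = f i j x \<otimes>\<^bsub>G j\<^esub> f i j y"
  using hom by (auto simp: hom_def)

lemma group_hom_f: "\<lbrakk>i \<in> I; j \<in> I; leq i j\<rbrakk> \<Longrightarrow> group_hom (G i) (G j) (f i j)"
  by (simp add: group_hom_def group_hom_axioms_def group hom)

lemma f_pow: "\<lbrakk>i \<in> I; j \<in> I; leq i j; x \<in> carrier (G i)\<rbrakk>
    \<Longrightarrow> f i j (x [^]\<^bsub>G i\<^esub> (n::nat)) = f i j x [^]\<^bsub>G j\<^esub> n"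
  using group_hom.hom_nat_pow[OF group_hom_f] by blast

lemma rel_iff: "((i, x), (j, y)) \<in> rel \<longleftrightarrow>
    i \<in> I \<and> x \<in> carrier (G i) \<and> j \<in> I \<and> y \<in> carrier (G j) \<and>
    (\<exists>k\<in>I. leq i k \<and> leq j k \<and> f i k x = f j k y)"
  by (simp add: direct_limit_rel_def)

lemma equal_later:
  assumes "i \<in> I" "j \<in> I" "k \<in> I" "l \<in> I" "leq i k" "leq j k" "leq k l"
    "x \<in> carrier (G i)" "y \<in> carrier (G j)" "f i k x = f j k y"
  shows "f i l x = f j l y"
  using assms compose[of i k l x] compose[of j k l y] by simp

lemma equiv_rel: "equiv (SIGMA i:I. carrier (G i)) rel"
proof (rule equivI)
  show "rel \<subseteq> (SIGMA i:I. carrier (G i)) \<times> (SIGMA i:I. carrier (G i))"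
    by (auto simp: direct_limit_rel_def)
  show "refl_on (SIGMA i:I. carrier (G i)) rel"
    by (rule refl_onI, clarsimp simp: rel_iff) (use leq_refl in blast)
  show "sym rel"
    by (rule symI) (auto simp: direct_limit_rel_def)
  show "trans rel"
  proof (rule transI, clarsimp simp: rel_iff)
    fix i x j y k z p q
    assume "i \<in> I" "x \<in> carrier (G i)" "j \<in> I" "y \<in> carrier (G j)" "k \<in> I" "z \<in> carrier (G k)"
      and p: "p \<in> I" "leq i p" "leq j p" "f i p x = f j p y"
      and q: "q \<in> I" "leq j q" "leq k q" "f j q y = f k q z"
    moreover obtain r where r: "r \<in> I" "leq p r" "leq q r"
      using directed p q by blast
    ultimately have "f i r x = f k r z" "leq i r" "leq k r"
      using equal_later[of i j p r x y] equal_later[of j k q r y z] leq_trans by metis+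
    then show "\<exists>l\<in>I. leq i l \<and> leq k l \<and> f i l x = f k l z"
      using r by blast
  qed
qed

lemma cls_eq_iff:
  assumes "i \<in> I" "x \<in> carrier (G i)" "j \<in> I" "y \<in> carrier (G j)"
  shows "cls i x = cls j y \<longleftrightarrow> (\<exists>k\<in>I. leq i k \<and> leq j k \<and> f i k x = f j k y)"
  using eq_equiv_class_iff[OF equiv_rel, of "(i, x)" "(j, y)"] assms rel_iff by auto

text \<open>\<open>f k k\<close> is not assumed to be the identity; \<open>compose\<close> makes it
  fix every image \<open>f i k x\<close>, which suffices for moving a class to a later
  index.\<close>

lemma cls_f:
  assumes "i \<in> I" "k \<in> I" "leq i k" "x \<in> carrier (G i)"
  shows "cls k (f i k x) = cls i x"
proof -
  have "f k k (f i k x) = f i k x"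
    using assms leq_refl by (intro compose)
  then show ?thesis
    using assms leq_refl[of k] closed[of i k x] by (subst cls_eq_iff) auto
qed

lemma carrier_L: "carrier L = {cls i x |i x. i \<in> I \<and> x \<in> carrier (G i)}"
  by (auto simp: direct_limit_def quotient_def)

text \<open>The product in the limit is a union over representatives and upper indices. It is a
  single class because any two choices become equal at an index above all those involved.\<close>

lemma mult_cls:
  assumes i: "i \<in> I" "x \<in> carrier (G i)" "y \<in> carrier (G i)"
  shows "cls i x \<otimes>\<^bsub>L\<^esub> cls i y = cls i (x \<otimes>\<^bsub>G i\<^esub> y)"
proof -
  have xy: "x \<otimes>\<^bsub>G i\<^esub> y \<in> carrier (G i)"
    using i group by (simp add: group.is_monoid monoid.m_closed)
  have *: "cls k (f a k u \<otimes>\<^bsub>G k\<^esub> f b k v) = cls i (x \<otimes>\<^bsub>G i\<^esub> y)"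
    if au: "(a, u) \<in> cls i x" and bv: "(b, v) \<in> cls i y" and k: "k \<in> I" "leq a k" "leq b k"
    for a u b v k
  proof -
    obtain p where p: "a \<in> I" "u \<in> carrier (G a)" "p \<in> I" "leq i p" "leq a p" "f i p x = f a p u"
      using au by (auto simp: rel_iff)
    obtain q where q: "b \<in> I" "v \<in> carrier (G b)" "q \<in> I" "leq i q" "leq b q" "f i q y = f b q v"
      using bv by (auto simp: rel_iff)
    \<comment> \<open>At \<open>p\<close> and \<open>q\<close> the representatives agree with
      \<open>x\<close> and \<open>y\<close>; the index \<open>s\<close> lies above both and above
      the index \<open>k\<close> where the product is formed.\<close>
    obtain r where r: "r \<in> I" "leq p r" "leq q r"
      using directed p q by blast
    obtain s where s: "s \<in> I" "leq r s" "leq k s"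
      using directed r k by blast
    have ps: "leq p s" "leq q s"
      using leq_trans[of p r s] leq_trans[of q r s] p q r s by auto
    have i_s: "leq i s"
      using leq_trans[of i p s] i p s ps by auto
    have x: "f i s x = f a s u"
      by (rule equal_later[of i a p s]) (use i p s ps in auto)
    have y: "f i s y = f b s v"
      by (rule equal_later[of i b q s]) (use i q s ps in auto)
    have cl: "f a k u \<in> carrier (G k)" "f b k v \<in> carrier (G k)"
      using p q k closed by auto
    have "f k s (f a k u \<otimes>\<^bsub>G k\<^esub> f b k v) = f k s (f a k u) \<otimes>\<^bsub>G s\<^esub> f k s (f b k v)"
      using k s cl by (intro f_mult) auto
    also have "\<dots> = f a s u \<otimes>\<^bsub>G s\<^esub> f b s v"
      using compose[of a k s u] compose[of b k s v] p q k s by simp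
    also have "\<dots> = f i s (x \<otimes>\<^bsub>G i\<^esub> y)"
      using f_mult[of i s x y] i s i_s x y by simp
    finally have "f k s (f a k u \<otimes>\<^bsub>G k\<^esub> f b k v) = f i s (x \<otimes>\<^bsub>G i\<^esub> y)" .
    moreover have "f a k u \<otimes>\<^bsub>G k\<^esub> f b k v \<in> carrier (G k)"
      using cl k group by (simp add: group.is_monoid monoid.m_closed)
    ultimately show ?thesis
      using cls_eq_iff k i xy s i_s by blast
  qed
  have mem: "(i, x) \<in> cls i x" "(i, y) \<in> cls i y"
    using i leq_refl by (auto simp: rel_iff)
  have "cls i x \<otimes>\<^bsub>L\<^esub> cls i y = (\<Union>(a, u)\<in>cls i x. \<Union>(b, v)\<in>cls i y.
      \<Union>k\<in>{k \<in> I. leq a k \<and> leq b k}. cls k (f a k u \<otimes>\<^bsub>G k\<^esub> f b k v))"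
    by (simp add: direct_limit_def)
  also have "\<dots> = cls i (x \<otimes>\<^bsub>G i\<^esub> y)" (is "?U = _")
  proof (rule antisym)
    show "?U \<subseteq> cls i (x \<otimes>\<^bsub>G i\<^esub> y)"
    proof
      fix z assume "z \<in> ?U"
      then obtain a u b v k where "((i, x), (a, u)) \<in> rel" "((i, y), (b, v)) \<in> rel"
        "k \<in> I" "leq a k" "leq b k" "((k, f a k u \<otimes>\<^bsub>G k\<^esub> f b k v), z) \<in> rel"
        by auto
      then show "z \<in> cls i (x \<otimes>\<^bsub>G i\<^esub> y)"
        using * by blast
    qed
    show "cls i (x \<otimes>\<^bsub>G i\<^esub> y) \<subseteq> ?U"
    proof
      fix z assume "z \<in> cls i (x \<otimes>\<^bsub>G i\<^esub> y)"
      then have "z \<in> cls i (f i i x \<otimes>\<^bsub>G i\<^esub> f i i y)"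
        using *[OF mem] i leq_refl by blast
      then show "z \<in> ?U"
        using mem i leq_refl by blast
    qed
  qed
  finally show ?thesis .
qed

lemma one_cls:
  assumes "i \<in> I"
  shows "\<one>\<^bsub>L\<^esub> = cls i \<one>\<^bsub>G i\<^esub>"
proof -
  have "cls j \<one>\<^bsub>G j\<^esub> = cls i \<one>\<^bsub>G i\<^esub>" if "j \<in> I" for j
  proof -
    obtain k where "k \<in> I" "leq i k" "leq j k"
      using directed assms \<open>j \<in> I\<close> by blast
    moreover have "f i k \<one>\<^bsub>G i\<^esub> = f j k \<one>\<^bsub>G j\<^esub>"
      using group_hom.hom_one[OF group_hom_f] assms that calculation by metis
    ultimately show ?thesis
      using assms that group by (subst cls_eq_iff) (auto simp: group.is_monoid)
  qed
  then have "(\<Union>j\<in>I. cls j \<one>\<^bsub>G j\<^esub>) = cls i \<one>\<^bsub>G i\<^esub>"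
    using assms by blast
  then show ?thesis
    by (simp add: direct_limit_def)
qed

lemma pow_cls:
  assumes "i \<in> I" "x \<in> carrier (G i)"
  shows "cls i x [^]\<^bsub>L\<^esub> (n::nat) = cls i (x [^]\<^bsub>G i\<^esub> n)"
proof (induction n)
  case 0
  then show ?case using one_cls[OF assms(1)] by simp
next
  case (Suc n)
  have "x [^]\<^bsub>G i\<^esub> n \<in> carrier (G i)"
    using assms group by (simp add: group.is_monoid monoid.nat_pow_closed)
  then show ?case
    using mult_cls assms Suc by simp
qed

text \<open>An equation between two classes is witnessed at some later index, so divisibility of the
  limit can be tested inside the groups \<open>G k\<close>.\<close>

lemma divisible_by_direct_limit_iff:
  "divisible_by n L \<longleftrightarrow>
     (\<forall>i\<in>I. \<forall>x\<in>carrier (G i). \<exists>k\<in>I. leq i k \<and> (\<exists>y\<in>carrier (G k). f i k x = y [^]\<^bsub>G k\<^esub> n))"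
    (is "_ \<longleftrightarrow> ?R")
proof
  assume div: "divisible_by n L"
  show ?R
  proof (intro ballI)
    fix i x assume i: "i \<in> I" "x \<in> carrier (G i)"
    then have "cls i x \<in> carrier L"
      by (auto simp: carrier_L)
    then obtain j y where j: "j \<in> I" "y \<in> carrier (G j)" and "cls j y [^]\<^bsub>L\<^esub> n = cls i x"
      using div unfolding divisible_by_def carrier_L by blast
    then have "cls i x = cls j (y [^]\<^bsub>G j\<^esub> n)"
      by (simp add: pow_cls)
    moreover have "y [^]\<^bsub>G j\<^esub> n \<in> carrier (G j)"
      using j group by (simp add: group.is_monoid monoid.nat_pow_closed)
    ultimately obtain k where k: "k \<in> I" "leq i k" "leq j k" "f i k x = f j k (y [^]\<^bsub>G j\<^esub> n)"
      using cls_eq_iff i j by blast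
    then have "f i k x = f j k y [^]\<^bsub>G k\<^esub> n"
      using f_pow j by simp
    then show "\<exists>k\<in>I. leq i k \<and> (\<exists>y\<in>carrier (G k). f i k x = y [^]\<^bsub>G k\<^esub> n)"
      using k j closed by blast
  qed
next
  assume R: ?R
  show "divisible_by n L"
    unfolding divisible_by_def
  proof
    fix a assume "a \<in> carrier L"
    then obtain i x where i: "i \<in> I" "x \<in> carrier (G i)" "a = cls i x"
      by (auto simp: carrier_L)
    then obtain k y where k: "k \<in> I" "leq i k" "y \<in> carrier (G k)" "f i k x = y [^]\<^bsub>G k\<^esub> n"
      using R by blast
    then have "cls k y [^]\<^bsub>L\<^esub> n = a"
      using cls_f[of i k x] i pow_cls[of k y n] by simp
    then show "\<exists>b\<in>carrier L. b [^]\<^bsub>L\<^esub> n = a"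
      using k carrier_L by blast
  qed
qed

end

section \<open>First Cech cohomology in terms of cocycles\<close>

text \<open>Cochains become functions of two cover members, with no condition on disjoint pairs, so
  that they can be given by formulas. \<open>pair_values\<close> and \<open>pair_cochain\<close>
  translate from and to extensional functions on lists.\<close>

definition cocycle1 :: "'a set set \<Rightarrow> ('a set \<Rightarrow> 'a set \<Rightarrow> int) \<Rightarrow> bool" where
  "cocycle1 \<U> c \<longleftrightarrow>
     (\<forall>A\<in>\<U>. \<forall>B\<in>\<U>. \<forall>C\<in>\<U>. A \<inter> B \<inter> C \<noteq> {} \<longrightarrow> c A C = c A B + c B C)"

definition cohomologous1 ::
  "'a set set \<Rightarrow> ('a set \<Rightarrow> 'a set \<Rightarrow> int) \<Rightarrow> ('a set \<Rightarrow> 'a set \<Rightarrow> int) \<Rightarrow> bool" where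
  "cohomologous1 \<U> c d \<longleftrightarrow>
     (\<exists>e. \<forall>A\<in>\<U>. \<forall>B\<in>\<U>. A \<inter> B \<noteq> {} \<longrightarrow> c A B = d A B + e B - e A)"

abbreviation pair_values :: "('a set list \<Rightarrow> int) \<Rightarrow> 'a set \<Rightarrow> 'a set \<Rightarrow> int" where
  "pair_values c \<equiv> \<lambda>A B. c [A, B]"

abbreviation pair_cochain :: "'a set set \<Rightarrow> ('a set \<Rightarrow> 'a set \<Rightarrow> int) \<Rightarrow> 'a set list \<Rightarrow> int" where
  "pair_cochain \<U> c \<equiv> (\<lambda>s\<in>nerve \<U> (Suc 0). c (s ! 0) (s ! 1))"

lemma cocycle1D:
  "\<lbrakk>cocycle1 \<U> c; A \<in> \<U>; B \<in> \<U>; C \<in> \<U>; A \<inter> B \<inter> C \<noteq> {}\<rbrakk> \<Longrightarrow> c A C = c A B + c B C"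
  unfolding cocycle1_def by blast

text \<open>Cochains are not assumed alternating, so the diagonal and antisymmetry come from the
  cocycle identity on simplices with repeated vertices: \<open>[A, A, A]\<close> here and
  \<open>[A, B, A]\<close> in the next lemma.\<close>

lemma cocycle1_diag: "\<lbrakk>cocycle1 \<U> c; A \<in> \<U>; A \<noteq> {}\<rbrakk> \<Longrightarrow> c A A = 0"
  using cocycle1D[of \<U> c A A A] by simp

lemma cocycle1_swap:
  "\<lbrakk>cocycle1 \<U> c; A \<in> \<U>; B \<in> \<U>; A \<inter> B \<noteq> {}\<rbrakk> \<Longrightarrow> c B A = - c A B"
  using cocycle1D[of \<U> c A B A] cocycle1_diag[of \<U> c A] by (cases "A = {}") (auto simp: Int_commute)

lemma cohomologous1E:
  assumes "cohomologous1 \<U> c d"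
  obtains e where "\<And>A B. \<lbrakk>A \<in> \<U>; B \<in> \<U>; A \<inter> B \<noteq> {}\<rbrakk> \<Longrightarrow> c A B = d A B + e B - e A"
  using assms unfolding cohomologous1_def by metis

lemma cohomologous1_refl: "cohomologous1 \<U> c c"
  unfolding cohomologous1_def by (rule exI[of _ "\<lambda>_. 0"]) simp

lemma cohomologous1_sym:
  assumes "cohomologous1 \<U> c d"
  shows "cohomologous1 \<U> d c"
proof -
  obtain e where e: "\<And>A B. \<lbrakk>A \<in> \<U>; B \<in> \<U>; A \<inter> B \<noteq> {}\<rbrakk> \<Longrightarrow> c A B = d A B + e B - e A"
    by (rule cohomologous1E[OF assms]) blast
  show ?thesis
    unfolding cohomologous1_def
    by (rule exI[of _ "\<lambda>A. - e A"], intro ballI impI) (subst e, assumption+, simp)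
qed

lemma cohomologous1_trans:
  assumes "cohomologous1 \<U> b c" "cohomologous1 \<U> c d"
  shows "cohomologous1 \<U> b d"
proof -
  obtain e where e: "\<And>A B. \<lbrakk>A \<in> \<U>; B \<in> \<U>; A \<inter> B \<noteq> {}\<rbrakk> \<Longrightarrow> b A B = c A B + e B - e A"
    by (rule cohomologous1E[OF assms(1)]) blast
  obtain e' where e': "\<And>A B. \<lbrakk>A \<in> \<U>; B \<in> \<U>; A \<inter> B \<noteq> {}\<rbrakk> \<Longrightarrow> c A B = d A B + e' B - e' A"
    by (rule cohomologous1E[OF assms(2)]) blast
  show ?thesis
    unfolding cohomologous1_def
    by (rule exI[of _ "\<lambda>A. e A + e' A"], intro ballI impI)
      (subst e, assumption+, subst e', assumption+, simp)
qed

lemma refinement_mapsD: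
  assumes "\<rho> \<in> refinement_maps \<U> \<V>" "A \<in> \<V>"
  shows "\<rho> A \<in> \<U>" "x \<in> A \<Longrightarrow> x \<in> \<rho> A"
  using assms unfolding refinement_maps_def by auto

lemma cohomologous1_pullback:
  assumes "cohomologous1 \<U> c d" "\<rho> \<in> refinement_maps \<U> \<V>"
  shows "cohomologous1 \<V> (\<lambda>A B. c (\<rho> A) (\<rho> B)) (\<lambda>A B. d (\<rho> A) (\<rho> B))"
proof -
  obtain e where e: "\<And>A B. \<lbrakk>A \<in> \<U>; B \<in> \<U>; A \<inter> B \<noteq> {}\<rbrakk> \<Longrightarrow> c A B = d A B + e B - e A"
    by (rule cohomologous1E[OF assms(1)]) blast
  show ?thesis
    unfolding cohomologous1_def
  proof (rule exI[of _ "e \<circ> \<rho>"], intro ballI impI)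
    fix A B assume AB: "A \<in> \<V>" "B \<in> \<V>" "A \<inter> B \<noteq> {}"
    then obtain x where "x \<in> \<rho> A" "x \<in> \<rho> B"
      using refinement_mapsD(2)[OF assms(2)] by (meson Int_emptyI)
    then show "c (\<rho> A) (\<rho> B) = d (\<rho> A) (\<rho> B) + (e \<circ> \<rho>) B - (e \<circ> \<rho>) A"
      using e[of "\<rho> A" "\<rho> B"] refinement_mapsD(1)[OF assms(2)] AB by auto
  qed
qed

lemma cocycle1_pullback:
  assumes "cocycle1 \<U> c" "\<rho> \<in> refinement_maps \<U> \<V>"
  shows "cocycle1 \<V> (\<lambda>A B. c (\<rho> A) (\<rho> B))"
  unfolding cocycle1_def
proof (intro ballI impI)
  fix A B C assume *: "A \<in> \<V>" "B \<in> \<V>" "C \<in> \<V>" "A \<inter> B \<inter> C \<noteq> {}"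
  then obtain x where "x \<in> A" "x \<in> B" "x \<in> C"
    by auto
  then have "x \<in> \<rho> A \<inter> \<rho> B \<inter> \<rho> C"
    using refinement_mapsD(2)[OF assms(2)] * by simp
  then show "c (\<rho> A) (\<rho> C) = c (\<rho> A) (\<rho> B) + c (\<rho> B) (\<rho> C)"
    using refinement_mapsD(1)[OF assms(2)] * by (intro cocycle1D[OF assms(1)]) auto
qed

text \<open>The chain homotopy between contiguous simplicial maps. A point common to
  \<open>A\<close> and \<open>B\<close> lies in all four images, so the cocycle identity applies to
  the two triangles subdividing the square they span. The correcting 0-cochain is the edge from
  \<open>\<sigma> A\<close> to \<open>\<rho> A\<close>.\<close>

lemma pullback_homotopy:
  assumes c: "cocycle1 \<U> c" and "\<rho> \<in> refinement_maps \<U> \<V>" "\<sigma> \<in> refinement_maps \<U> \<V>"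
  shows "cohomologous1 \<V> (\<lambda>A B. c (\<rho> A) (\<rho> B)) (\<lambda>A B. c (\<sigma> A) (\<sigma> B))"
  unfolding cohomologous1_def
proof (rule exI[of _ "\<lambda>A. c (\<sigma> A) (\<rho> A)"], intro ballI impI)
  fix A B assume AB: "A \<in> \<V>" "B \<in> \<V>" "A \<inter> B \<noteq> {}"
  then have mem: "\<rho> A \<in> \<U>" "\<sigma> A \<in> \<U>" "\<rho> B \<in> \<U>" "\<sigma> B \<in> \<U>"
    using refinement_mapsD(1) assms(2,3) by blast+
  obtain x where "x \<in> A" "x \<in> B"
    using AB by auto
  then have x: "x \<in> \<rho> A" "x \<in> \<rho> B" "x \<in> \<sigma> A" "x \<in> \<sigma> B"
    using refinement_mapsD(2)[OF assms(2)] refinement_mapsD(2)[OF assms(3)] AB by auto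
  then have ne: "\<rho> A \<inter> \<sigma> A \<inter> \<rho> B \<noteq> {}" "\<sigma> A \<inter> \<sigma> B \<inter> \<rho> B \<noteq> {}" "\<rho> A \<inter> \<sigma> A \<noteq> {}"
    by blast+
  have "c (\<rho> A) (\<rho> B) = c (\<rho> A) (\<sigma> A) + c (\<sigma> A) (\<rho> B)"
    "c (\<sigma> A) (\<rho> B) = c (\<sigma> A) (\<sigma> B) + c (\<sigma> B) (\<rho> B)"
    "c (\<sigma> A) (\<rho> A) = - c (\<rho> A) (\<sigma> A)"
    using cocycle1D[OF c mem(1,2,3)] cocycle1D[OF c mem(2,4,3)] cocycle1_swap[OF c mem(1,2)] ne by auto
  then show "c (\<rho> A) (\<rho> B) = c (\<sigma> A) (\<sigma> B) + c (\<sigma> B) (\<rho> B) - c (\<sigma> A) (\<rho> A)"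
    by simp
qed

section \<open>Cochains of degrees 0, 1 and 2 on the nerve\<close>

lemma mem_nerve_0:
  "s \<in> nerve \<U> 0 \<longleftrightarrow> (\<exists>A. s = [A] \<and> A \<in> \<U> \<and> A \<noteq> {})"
  by (cases s) (auto simp: nerve_def)

lemma mem_nerve_1:
  "s \<in> nerve \<U> (Suc 0) \<longleftrightarrow> (\<exists>A B. s = [A, B] \<and> A \<in> \<U> \<and> B \<in> \<U> \<and> A \<inter> B \<noteq> {})"
proof
  assume "s \<in> nerve \<U> (Suc 0)"
  moreover from this obtain A B where "s = [A, B]"
    by (auto simp: nerve_def length_Suc_conv)
  ultimately show "\<exists>A B. s = [A, B] \<and> A \<in> \<U> \<and> B \<in> \<U> \<and> A \<inter> B \<noteq> {}"
    by (simp add: nerve_def)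
qed (auto simp: nerve_def)

lemma mem_nerve_2:
  "s \<in> nerve \<U> (Suc (Suc 0)) \<longleftrightarrow>
     (\<exists>A B C. s = [A, B, C] \<and> A \<in> \<U> \<and> B \<in> \<U> \<and> C \<in> \<U> \<and> A \<inter> B \<inter> C \<noteq> {})"
proof
  assume "s \<in> nerve \<U> (Suc (Suc 0))"
  moreover from this obtain A B C where "s = [A, B, C]"
    by (auto simp: nerve_def length_Suc_conv)
  ultimately show "\<exists>A B C. s = [A, B, C] \<and> A \<in> \<U> \<and> B \<in> \<U> \<and> C \<in> \<U> \<and> A \<inter> B \<inter> C \<noteq> {}"
    by (simp add: nerve_def Int_assoc)
qed (auto simp: nerve_def)

lemma carrier_cochain_group: "carrier (cochain_group \<U> q) = extensional (nerve \<U> q)"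
  by (auto simp: cochain_group_def integer_group_def PiE_def)

lemma mult_cochain_group: "c \<otimes>\<^bsub>cochain_group \<U> q\<^esub> d = (\<lambda>s\<in>nerve \<U> q. c s + d s)"
  by (simp add: cochain_group_def integer_group_def)

lemma one_cochain_group: "\<one>\<^bsub>cochain_group \<U> q\<^esub> = (\<lambda>s\<in>nerve \<U> q. 0)"
  by (simp add: cochain_group_def integer_group_def)

lemma comm_group_cochain_group: "comm_group (cochain_group \<U> q)"
proof (rule group.group_comm_groupI)
  show "group (cochain_group \<U> q)"
    by (simp add: cochain_group_def)
qed (auto simp: mult_cochain_group add.commute)

lemma inv_cochain_group:
  "c \<in> extensional (nerve \<U> q) \<Longrightarrow> inv\<^bsub>cochain_group \<U> q\<^esub> c = (\<lambda>s\<in>nerve \<U> q. - c s)"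
  by (simp add: cochain_group_def PiE_def)

lemma pow_cochain_group:
  "c \<in> extensional (nerve \<U> q) \<Longrightarrow>
    c [^]\<^bsub>cochain_group \<U> q\<^esub> (n::nat) = (\<lambda>s\<in>nerve \<U> q. int n * c s)"
  by (induction n) (auto simp: one_cochain_group mult_cochain_group algebra_simps)

lemma coboundary_0:
  "\<lbrakk>A \<in> \<U>; B \<in> \<U>; A \<inter> B \<noteq> {}\<rbrakk> \<Longrightarrow> coboundary \<U> 0 e [A, B] = e [B] - e [A]"
  by (simp add: coboundary_def mem_nerve_1)

lemma coboundary_1:
  "\<lbrakk>A \<in> \<U>; B \<in> \<U>; C \<in> \<U>; A \<inter> B \<inter> C \<noteq> {}\<rbrakk>
    \<Longrightarrow> coboundary \<U> (Suc 0) c [A, B, C] = c [B, C] - c [A, C] + c [A, B]"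
  by (simp add: coboundary_def mem_nerve_2)

lemma coboundary_extensional: "coboundary \<U> q c \<in> extensional (nerve \<U> (Suc q))"
  by (simp add: coboundary_def)

lemma cocycles_iff:
  "c \<in> cocycles \<U> (Suc 0) \<longleftrightarrow>
    c \<in> extensional (nerve \<U> (Suc 0)) \<and> cocycle1 \<U> (pair_values c)"
proof -
  have "coboundary \<U> (Suc 0) c = \<one>\<^bsub>cochain_group \<U> (Suc (Suc 0))\<^esub> \<longleftrightarrow> cocycle1 \<U> (pair_values c)"
    (is "?L = ?R \<longleftrightarrow> _")
  proof
    assume eq: "?L = ?R"
    show "cocycle1 \<U> (pair_values c)"
      unfolding cocycle1_def
    proof (intro ballI impI)
      fix A B C assume ABC: "A \<in> \<U>" "B \<in> \<U>" "C \<in> \<U>" "A \<inter> B \<inter> C \<noteq> {}"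
      then have "?L [A, B, C] = 0"
        unfolding eq one_cochain_group by (simp add: mem_nerve_2)
      then show "c [A, C] = c [A, B] + c [B, C]"
        unfolding coboundary_1[OF ABC] by linarith
    qed
  next
    assume c: "cocycle1 \<U> (pair_values c)"
    show "?L = ?R"
    proof (rule extensionalityI[OF coboundary_extensional])
      fix s assume s: "s \<in> nerve \<U> (Suc (Suc 0))"
      then obtain A B C
        where ABC: "A \<in> \<U>" "B \<in> \<U>" "C \<in> \<U>" "A \<inter> B \<inter> C \<noteq> {}" and "s = [A, B, C]"
        unfolding mem_nerve_2 by metis
      then show "?L s = ?R s"
        using s cocycle1D[OF c ABC] coboundary_1[OF ABC, of c] by (simp add: one_cochain_group)
    qed (simp add: one_cochain_group)
  qed
  then show ?thesis
    by (simp add: cocycles_def kernel_def carrier_cochain_group)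
qed

lemma coboundaries_iff:
  "c \<in> coboundaries \<U> (Suc 0) \<longleftrightarrow>
    c \<in> extensional (nerve \<U> (Suc 0)) \<and> cohomologous1 \<U> (pair_values c) (\<lambda>_ _. 0)"
proof
  assume "c \<in> coboundaries \<U> (Suc 0)"
  then obtain e where e: "c = coboundary \<U> 0 e"
    by auto
  have "cohomologous1 \<U> (pair_values c) (\<lambda>_ _. 0)"
    unfolding cohomologous1_def e
    by (rule exI[of _ "\<lambda>A. e [A]"], intro ballI impI) (simp add: coboundary_0)
  then show "c \<in> extensional (nerve \<U> (Suc 0)) \<and> cohomologous1 \<U> (pair_values c) (\<lambda>_ _. 0)"
    by (simp add: e coboundary_extensional)
next
  assume *: "c \<in> extensional (nerve \<U> (Suc 0)) \<and> cohomologous1 \<U> (pair_values c) (\<lambda>_ _. 0)"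
  obtain e where e: "\<And>A B. \<lbrakk>A \<in> \<U>; B \<in> \<U>; A \<inter> B \<noteq> {}\<rbrakk> \<Longrightarrow> c [A, B] = 0 + e B - e A"
    by (rule cohomologous1E[OF conjunct2[OF *]]) blast
  \<comment> \<open>0-cochains live on one-vertex lists and are extensional, so \<open>e\<close> is
    transported along \<open>hd\<close> and cut off outside the nerve.\<close>
  define e0 where "e0 = (\<lambda>s\<in>nerve \<U> 0. e (hd s))"
  have "c = coboundary \<U> 0 e0"
  proof (rule extensionalityI[OF conjunct1[OF *] coboundary_extensional])
    fix s assume "s \<in> nerve \<U> (Suc 0)"
    then obtain A B where AB: "A \<in> \<U>" "B \<in> \<U>" "A \<inter> B \<noteq> {}" and s: "s = [A, B]"
      unfolding mem_nerve_1 by metis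
    then have "e0 [A] = e A" "e0 [B] = e B"
      by (auto simp: e0_def mem_nerve_0)
    then show "c s = coboundary \<U> 0 e0 s"
      using e[OF AB] coboundary_0[OF AB, of e0] s by simp
  qed
  moreover have "e0 \<in> carrier (cochain_group \<U> 0)"
    by (simp add: e0_def carrier_cochain_group)
  ultimately show "c \<in> coboundaries \<U> (Suc 0)"
    by simp
qed

section \<open>Degree 1 cohomology of a single cover\<close>

abbreviation cocycle_group :: "'a set set \<Rightarrow> ('a set list \<Rightarrow> int) monoid" where
  "cocycle_group \<U> \<equiv> (cochain_group \<U> (Suc 0))\<lparr>carrier := cocycles \<U> (Suc 0)\<rparr>"

abbreviation coho_class :: "'a set set \<Rightarrow> ('a set list \<Rightarrow> int) \<Rightarrow> ('a set list \<Rightarrow> int) set" where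
  "coho_class \<U> c \<equiv> coboundaries \<U> (Suc 0) #>\<^bsub>cochain_group \<U> (Suc 0)\<^esub> c"

text \<open>Through this lemma, equations in the quotient group become statements about pairs of
  intersecting sets.\<close>

lemma mem_coho_class:
  assumes "c \<in> extensional (nerve \<U> (Suc 0))"
  shows "d \<in> coho_class \<U> c \<longleftrightarrow>
    d \<in> extensional (nerve \<U> (Suc 0)) \<and> cohomologous1 \<U> (pair_values d) (pair_values c)"
proof
  assume "d \<in> coho_class \<U> c"
  then obtain b where "b \<in> coboundaries \<U> (Suc 0)" and d: "d = (\<lambda>s\<in>nerve \<U> (Suc 0). b s + c s)"
    unfolding r_coset_def mult_cochain_group by blast
  then have "cohomologous1 \<U> (pair_values b) (\<lambda>_ _. 0)"
    by (simp only: coboundaries_iff)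
  then obtain e where e: "\<And>A B. \<lbrakk>A \<in> \<U>; B \<in> \<U>; A \<inter> B \<noteq> {}\<rbrakk> \<Longrightarrow> b [A, B] = 0 + e B - e A"
    by (rule cohomologous1E) blast
  have "cohomologous1 \<U> (pair_values d) (pair_values c)"
    unfolding cohomologous1_def d
    by (rule exI[of _ e], intro ballI impI) (simp add: mem_nerve_1 e)
  then show "d \<in> extensional (nerve \<U> (Suc 0)) \<and> cohomologous1 \<U> (pair_values d) (pair_values c)"
    by (simp add: d)
next
  assume d: "d \<in> extensional (nerve \<U> (Suc 0)) \<and> cohomologous1 \<U> (pair_values d) (pair_values c)"
  define b where "b = (\<lambda>s\<in>nerve \<U> (Suc 0). d s - c s)"
  obtain e where e: "\<And>A B. \<lbrakk>A \<in> \<U>; B \<in> \<U>; A \<inter> B \<noteq> {}\<rbrakk> \<Longrightarrow> d [A, B] = c [A, B] + e B - e A"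
    by (rule cohomologous1E[OF conjunct2[OF d]]) blast
  have "cohomologous1 \<U> (pair_values b) (\<lambda>_ _. 0)"
    unfolding cohomologous1_def b_def
    by (rule exI[of _ e], intro ballI impI) (simp add: mem_nerve_1 e)
  then have "b \<in> coboundaries \<U> (Suc 0)"
    unfolding coboundaries_iff by (simp add: b_def)
  moreover have "d = b \<otimes>\<^bsub>cochain_group \<U> (Suc 0)\<^esub> c"
    by (rule extensionalityI[of _ "nerve \<U> (Suc 0)"])
      (use d in \<open>simp_all add: mult_cochain_group b_def\<close>)
  ultimately show "d \<in> coho_class \<U> c"
    unfolding r_coset_def by blast
qed

lemma coho_class_eq_iff:
  assumes "c \<in> extensional (nerve \<U> (Suc 0))" "d \<in> extensional (nerve \<U> (Suc 0))"
  shows "coho_class \<U> c = coho_class \<U> d \<longleftrightarrow> cohomologous1 \<U> (pair_values c) (pair_values d)"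
proof
  assume eq: "coho_class \<U> c = coho_class \<U> d"
  have "c \<in> coho_class \<U> c"
    unfolding mem_coho_class[OF assms(1)] by (intro conjI assms(1) cohomologous1_refl)
  then show "cohomologous1 \<U> (pair_values c) (pair_values d)"
    unfolding eq mem_coho_class[OF assms(2)] by (rule conjunct2)
next
  assume *: "cohomologous1 \<U> (pair_values c) (pair_values d)"
  show "coho_class \<U> c = coho_class \<U> d"
  proof (rule Set.set_eqI)
    show "b \<in> coho_class \<U> c \<longleftrightarrow> b \<in> coho_class \<U> d" for b
      unfolding mem_coho_class[OF assms(1)] mem_coho_class[OF assms(2)]
      using cohomologous1_trans[OF _ *] cohomologous1_trans[OF _ cohomologous1_sym[OF *]] by iprover
  qed
qed

text \<open>From here on coboundaries are reached through \<open>coboundaries_iff\<close> or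
  unfolded explicitly; the simplifier should leave the cosets \<open>coho_class\<close>
  folded.\<close>

declare coboundaries.simps [simp del]

lemma pair_values_pair_cochain:
  "\<lbrakk>A \<in> \<U>; B \<in> \<U>; A \<inter> B \<noteq> {}\<rbrakk> \<Longrightarrow> pair_cochain \<U> c [A, B] = c A B"
  by (simp add: mem_nerve_1)

lemma cocycle1_cong:
  assumes d: "cocycle1 \<U> d"
    and eq: "\<And>A B. \<lbrakk>A \<in> \<U>; B \<in> \<U>; A \<inter> B \<noteq> {}\<rbrakk> \<Longrightarrow> c A B = d A B"
  shows "cocycle1 \<U> c"
  unfolding cocycle1_def
proof (intro ballI impI)
  fix A B C assume ABC: "A \<in> \<U>" "B \<in> \<U>" "C \<in> \<U>" "A \<inter> B \<inter> C \<noteq> {}"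
  then have "A \<inter> B \<noteq> {}" "B \<inter> C \<noteq> {}" "A \<inter> C \<noteq> {}"
    by auto
  then show "c A C = c A B + c B C"
    using cocycle1D[OF d ABC] eq[of A B] eq[of B C] eq[of A C] ABC(1-3) by simp
qed

lemma cohomologous1_cong:
  assumes "cohomologous1 \<U> c' d'"
    and c: "\<And>A B. \<lbrakk>A \<in> \<U>; B \<in> \<U>; A \<inter> B \<noteq> {}\<rbrakk> \<Longrightarrow> c A B = c' A B"
    and d: "\<And>A B. \<lbrakk>A \<in> \<U>; B \<in> \<U>; A \<inter> B \<noteq> {}\<rbrakk> \<Longrightarrow> d A B = d' A B"
  shows "cohomologous1 \<U> c d"
proof -
  obtain e where e: "\<And>A B. \<lbrakk>A \<in> \<U>; B \<in> \<U>; A \<inter> B \<noteq> {}\<rbrakk> \<Longrightarrow> c' A B = d' A B + e B - e A"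
    by (rule cohomologous1E[OF assms(1)]) blast
  show ?thesis
    unfolding cohomologous1_def
  proof (rule exI[of _ e], intro ballI impI)
    fix A B assume AB: "A \<in> \<U>" "B \<in> \<U>" "A \<inter> B \<noteq> {}"
    show "c A B = d A B + e B - e A"
      using e[OF AB] c[OF AB] d[OF AB] by simp
  qed
qed

lemma pair_cochain_cocycle: "cocycle1 \<U> c \<Longrightarrow> pair_cochain \<U> c \<in> cocycles \<U> (Suc 0)"
  unfolding cocycles_iff
  by (intro conjI restrict_extensional) (erule cocycle1_cong, rule pair_values_pair_cochain)

lemma cocycles_subgroup: "subgroup (cocycles \<U> (Suc 0)) (cochain_group \<U> (Suc 0))"
proof -
  interpret comm_group "cochain_group \<U> (Suc 0)" by (rule comm_group_cochain_group)
  show ?thesis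
  proof (rule subgroupI)
    show "cocycles \<U> (Suc 0) \<subseteq> carrier (cochain_group \<U> (Suc 0))"
      by (auto simp: cocycles_iff carrier_cochain_group)
    have "cocycle1 \<U> (\<lambda>_ _. 0)"
      by (simp add: cocycle1_def)
    then have "pair_cochain \<U> (\<lambda>_ _. 0) \<in> cocycles \<U> (Suc 0)"
      by (rule pair_cochain_cocycle)
    then show "cocycles \<U> (Suc 0) \<noteq> {}"
      by (metis empty_iff)
    show "inv\<^bsub>cochain_group \<U> (Suc 0)\<^esub> a \<in> cocycles \<U> (Suc 0)" if "a \<in> cocycles \<U> (Suc 0)" for a
    proof -
      have a: "a \<in> extensional (nerve \<U> (Suc 0))" "cocycle1 \<U> (pair_values a)"
        using that by (simp_all add: cocycles_iff)
      have "cocycle1 \<U> (\<lambda>A B. - a [A, B])" (is "cocycle1 _ ?c")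
        unfolding cocycle1_def
        by (intro ballI impI) (subst cocycle1D[OF a(2)], assumption+, simp)
      then have "pair_cochain \<U> ?c \<in> cocycles \<U> (Suc 0)"
        by (rule pair_cochain_cocycle)
      moreover have "inv\<^bsub>cochain_group \<U> (Suc 0)\<^esub> a = pair_cochain \<U> (\<lambda>A B. - a [A, B])"
        unfolding inv_cochain_group[OF a(1)] by (rule restrict_ext) (metis mem_nerve_1 nth_Cons_0 nth_Cons_Suc One_nat_def)
      ultimately show ?thesis
        by (simp only:)
    qed
    show "a \<otimes>\<^bsub>cochain_group \<U> (Suc 0)\<^esub> b \<in> cocycles \<U> (Suc 0)"
      if "a \<in> cocycles \<U> (Suc 0)" "b \<in> cocycles \<U> (Suc 0)" for a b
    proof -
      have ab: "cocycle1 \<U> (pair_values a)" "cocycle1 \<U> (pair_values b)"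
        using that by (simp_all add: cocycles_iff)
      have "cocycle1 \<U> (\<lambda>A B. a [A, B] + b [A, B])" (is "cocycle1 _ ?c")
        unfolding cocycle1_def
        by (intro ballI impI) (subst cocycle1D[OF ab(1)], assumption+, subst cocycle1D[OF ab(2)], assumption+, simp)
      then have "pair_cochain \<U> ?c \<in> cocycles \<U> (Suc 0)"
        by (rule pair_cochain_cocycle)
      moreover have "a \<otimes>\<^bsub>cochain_group \<U> (Suc 0)\<^esub> b = pair_cochain \<U> (\<lambda>A B. a [A, B] + b [A, B])"
        unfolding mult_cochain_group by (rule restrict_ext) (metis mem_nerve_1 nth_Cons_0 nth_Cons_Suc One_nat_def)
      ultimately show ?thesis
        by (simp only:)
    qed
  qed
qed

lemma coboundaries_subset: "coboundaries \<U> (Suc 0) \<subseteq> cocycles \<U> (Suc 0)"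
proof
  fix c assume "c \<in> coboundaries \<U> (Suc 0)"
  then have c: "c \<in> extensional (nerve \<U> (Suc 0))" "cohomologous1 \<U> (pair_values c) (\<lambda>_ _. 0)"
    by (simp_all only: coboundaries_iff)
  obtain e where e: "\<And>A B. \<lbrakk>A \<in> \<U>; B \<in> \<U>; A \<inter> B \<noteq> {}\<rbrakk> \<Longrightarrow> c [A, B] = 0 + e B - e A"
    by (rule cohomologous1E[OF c(2)]) blast
  have "cocycle1 \<U> (\<lambda>A B. e B - e A)"
    by (simp add: cocycle1_def)
  then have "cocycle1 \<U> (pair_values c)"
    by (rule cocycle1_cong) (subst e, assumption+, simp)
  then show "c \<in> cocycles \<U> (Suc 0)"
    using c(1) by (simp add: cocycles_iff)
qed

lemma comm_group_cocycle_group: "comm_group (cocycle_group \<U>)"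
proof (rule group.group_comm_groupI)
  show "group (cocycle_group \<U>)"
    by (rule subgroup.subgroup_is_group[OF cocycles_subgroup
          comm_group.axioms(2)[OF comm_group_cochain_group]])
qed (simp add: mult_cochain_group add.commute)

lemma coboundary_hom:
  "coboundary \<U> 0 \<in> hom (cochain_group \<U> 0) (cochain_group \<U> (Suc 0))"
proof (rule homI)
  fix d e
  show "coboundary \<U> 0 (d \<otimes>\<^bsub>cochain_group \<U> 0\<^esub> e)
      = coboundary \<U> 0 d \<otimes>\<^bsub>cochain_group \<U> (Suc 0)\<^esub> coboundary \<U> 0 e"
  proof (rule extensionalityI[OF coboundary_extensional])
    fix s assume s: "s \<in> nerve \<U> (Suc 0)"
    then obtain A B where AB: "A \<in> \<U>" "B \<in> \<U>" "A \<inter> B \<noteq> {}" and "s = [A, B]"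
      unfolding mem_nerve_1 by metis
    moreover have "[A] \<in> nerve \<U> 0" "[B] \<in> nerve \<U> 0"
      using AB by (auto simp: mem_nerve_0)
    ultimately show "coboundary \<U> 0 (d \<otimes>\<^bsub>cochain_group \<U> 0\<^esub> e) s
      = (coboundary \<U> 0 d \<otimes>\<^bsub>cochain_group \<U> (Suc 0)\<^esub> coboundary \<U> 0 e) s"
      using s by (simp add: mult_cochain_group coboundary_0)
  qed (simp add: mult_cochain_group)
qed (simp add: carrier_cochain_group coboundary_extensional)

lemma coboundaries_normal: "coboundaries \<U> (Suc 0) \<lhd> cocycle_group \<U>"
proof -
  interpret group_hom "cochain_group \<U> 0" "cochain_group \<U> (Suc 0)" "coboundary \<U> 0"
    by (simp add: group_hom_def group_hom_axioms_def comm_group_cochain_group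
        comm_group.axioms coboundary_hom)
  have "subgroup (coboundaries \<U> (Suc 0)) (cochain_group \<U> (Suc 0))"
    using img_is_subgroup by (simp add: coboundaries.simps)
  then have "subgroup (coboundaries \<U> (Suc 0)) (cocycle_group \<U>)"
    using group.subgroup_incl[OF H.is_group] cocycles_subgroup coboundaries_subset by blast
  then show ?thesis
    by (rule comm_group.subgroup_imp_normal[OF comm_group_cocycle_group])
qed

lemma r_coset_cocycle_group: "H #>\<^bsub>cocycle_group \<U>\<^esub> c = H #>\<^bsub>cochain_group \<U> (Suc 0)\<^esub> c"
  by (simp add: r_coset_def)

lemma carrier_cover_cohomology:
  "carrier (cover_cohomology \<U> (Suc 0)) = coho_class \<U> ` cocycles \<U> (Suc 0)"
  unfolding cover_cohomology_def carrier_FactGroup r_coset_cocycle_group by simp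

lemma group_cover_cohomology: "group (cover_cohomology \<U> (Suc 0))"
  unfolding cover_cohomology_def by (rule normal.factorgroup_is_group[OF coboundaries_normal])

lemma coho_class_hom: "coho_class \<U> \<in> hom (cocycle_group \<U>) (cover_cohomology \<U> (Suc 0))"
  using normal.r_coset_hom_Mod[OF coboundaries_normal]
  unfolding cover_cohomology_def r_coset_cocycle_group .

lemma coho_class_pow:
  assumes "c \<in> cocycles \<U> (Suc 0)"
  shows "coho_class \<U> c [^]\<^bsub>cover_cohomology \<U> (Suc 0)\<^esub> (n::nat)
    = coho_class \<U> (\<lambda>s\<in>nerve \<U> (Suc 0). int n * c s)"
proof -
  interpret group_hom "cocycle_group \<U>" "cover_cohomology \<U> (Suc 0)" "coho_class \<U>"
    by (simp add: group_hom_def group_hom_axioms_def comm_group_cocycle_group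
        comm_group.axioms coho_class_hom group_cover_cohomology)
  have "c [^]\<^bsub>cocycle_group \<U>\<^esub> n = c [^]\<^bsub>cochain_group \<U> (Suc 0)\<^esub> n"
    by (simp add: nat_pow_def)
  then show ?thesis
    using hom_nat_pow[of c n] assms by (simp add: pow_cochain_group cocycles_iff)
qed

section \<open>Refinement of covers and passage to the limit\<close>

lemma cochain_pullback_eq:
  "cochain_pullback \<V> (Suc 0) \<rho> c = pair_cochain \<V> (\<lambda>A B. c [\<rho> A, \<rho> B])"
  unfolding cochain_pullback_def by (rule restrict_ext) (unfold mem_nerve_1, elim exE, simp)

lemma cochain_pullback_values:
  "\<lbrakk>A \<in> \<V>; B \<in> \<V>; A \<inter> B \<noteq> {}\<rbrakk> \<Longrightarrow> cochain_pullback \<V> (Suc 0) \<rho> c [A, B] = c [\<rho> A, \<rho> B]"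
  unfolding cochain_pullback_eq by (rule pair_values_pair_cochain)

lemma cochain_pullback_extensional: "cochain_pullback \<V> q \<rho> c \<in> extensional (nerve \<V> q)"
  by (simp add: cochain_pullback_def)

lemma cochain_pullback_cocycle:
  assumes "c \<in> cocycles \<U> (Suc 0)" "\<rho> \<in> refinement_maps \<U> \<V>"
  shows "cochain_pullback \<V> (Suc 0) \<rho> c \<in> cocycles \<V> (Suc 0)"
  unfolding cochain_pullback_eq
  using assms cocycle1_pullback[of \<U> "pair_values c"]
  by (intro pair_cochain_cocycle) (simp add: cocycles_iff)

text \<open>The cosets in the defining union agree: a change of representative is covered by
  \<open>cohomologous1_pullback\<close>, a change of refinement map by
  \<open>pullback_homotopy\<close>. Hence one fixed \<open>\<rho>\<close> computes the map.\<close>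

lemma cohomology_refinement_class:
  assumes c: "c \<in> cocycles \<U> (Suc 0)" and \<rho>: "\<rho> \<in> refinement_maps \<U> \<V>"
  shows "cohomology_refinement (Suc 0) \<U> \<V> (coho_class \<U> c)
    = coho_class \<V> (cochain_pullback \<V> (Suc 0) \<rho> c)"
proof -
  have c': "c \<in> extensional (nerve \<U> (Suc 0))" "cocycle1 \<U> (pair_values c)"
    using c by (simp_all add: cocycles_iff)
  have eq: "coho_class \<V> (cochain_pullback \<V> (Suc 0) \<sigma> d) = coho_class \<V> (cochain_pullback \<V> (Suc 0) \<rho> c)"
    if d: "d \<in> coho_class \<U> c" and \<sigma>: "\<sigma> \<in> refinement_maps \<U> \<V>" for d \<sigma>
  proof (rule iffD2[OF coho_class_eq_iff[OF cochain_pullback_extensional cochain_pullback_extensional]])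
    have "cohomologous1 \<U> (pair_values d) (pair_values c)"
      using d unfolding mem_coho_class[OF c'(1)] by (rule conjunct2)
    then have "cohomologous1 \<V> (\<lambda>A B. d [\<sigma> A, \<sigma> B]) (\<lambda>A B. c [\<sigma> A, \<sigma> B])"
      by (rule cohomologous1_pullback[OF _ \<sigma>])
    then have "cohomologous1 \<V> (\<lambda>A B. d [\<sigma> A, \<sigma> B]) (\<lambda>A B. c [\<rho> A, \<rho> B])"
      by (rule cohomologous1_trans[OF _ pullback_homotopy[OF c'(2) \<sigma> \<rho>]])
    then show "cohomologous1 \<V> (pair_values (cochain_pullback \<V> (Suc 0) \<sigma> d))
        (pair_values (cochain_pullback \<V> (Suc 0) \<rho> c))"
      by (rule cohomologous1_cong) (rule cochain_pullback_values; assumption)+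
  qed
  have mem: "c \<in> coho_class \<U> c"
    unfolding mem_coho_class[OF c'(1)] by (intro conjI c' cohomologous1_refl)
  show ?thesis
    unfolding cohomology_refinement_def
  proof (intro equalityI UN_least)
    show "coho_class \<V> (cochain_pullback \<V> (Suc 0) \<rho> c) \<subseteq>
      (\<Union>d\<in>coho_class \<U> c. \<Union>\<sigma>\<in>refinement_maps \<U> \<V>. coho_class \<V> (cochain_pullback \<V> (Suc 0) \<sigma> d))"
      by (intro subsetI UN_I[OF mem] UN_I[OF \<rho>])
  qed (rule equalityD1[OF eq])
qed

lemma refinement_maps_nonempty:
  assumes "refines \<V> \<U>"
  shows "refinement_maps \<U> \<V> \<noteq> {}"
proof -
  have "\<forall>V\<in>\<V>. \<exists>U. U \<in> \<U> \<and> V \<subseteq> U"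
    using assms unfolding refines_def by blast
  from bchoice[OF this] obtain \<rho> where "\<rho> \<in> refinement_maps \<U> \<V>"
    unfolding refinement_maps_def by blast
  then show ?thesis by blast
qed

lemma refinement_maps_compose:
  "\<lbrakk>\<rho> \<in> refinement_maps \<U> \<V>; \<sigma> \<in> refinement_maps \<V> \<W>\<rbrakk> \<Longrightarrow> \<rho> \<circ> \<sigma> \<in> refinement_maps \<U> \<W>"
  by (simp add: refinement_maps_def) (meson order_trans)

text \<open>The product over \<open>\<U>\<close> is cut off outside the nerve. A refinement map
  sends intersecting members to intersecting members, so the cutoff is never met.\<close>

lemma cochain_pullback_mult:
  assumes "\<rho> \<in> refinement_maps \<U> \<V>"
  shows "cochain_pullback \<V> (Suc 0) \<rho> (c \<otimes>\<^bsub>cochain_group \<U> (Suc 0)\<^esub> d) =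
    cochain_pullback \<V> (Suc 0) \<rho> c \<otimes>\<^bsub>cochain_group \<V> (Suc 0)\<^esub> cochain_pullback \<V> (Suc 0) \<rho> d"
proof (rule extensionalityI[OF cochain_pullback_extensional])
  fix s assume s: "s \<in> nerve \<V> (Suc 0)"
  then obtain A B where AB: "A \<in> \<V>" "B \<in> \<V>" "A \<inter> B \<noteq> {}" and s': "s = [A, B]"
    unfolding mem_nerve_1 by metis
  obtain x where "x \<in> A" "x \<in> B"
    using AB(3) by auto
  then have "x \<in> \<rho> A" "x \<in> \<rho> B" "\<rho> A \<in> \<U>" "\<rho> B \<in> \<U>"
    using AB refinement_mapsD[OF assms] by blast+
  then have "[\<rho> A, \<rho> B] \<in> nerve \<U> (Suc 0)"
    unfolding mem_nerve_1 by blast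
  then show "cochain_pullback \<V> (Suc 0) \<rho> (c \<otimes>\<^bsub>cochain_group \<U> (Suc 0)\<^esub> d) s =
    (cochain_pullback \<V> (Suc 0) \<rho> c \<otimes>\<^bsub>cochain_group \<V> (Suc 0)\<^esub> cochain_pullback \<V> (Suc 0) \<rho> d) s"
    using s by (simp add: s' mult_cochain_group cochain_pullback_values[OF AB])
qed (simp add: mult_cochain_group)

lemma cohomology_refinement_hom:
  assumes "refines \<V> \<U>"
  shows "cohomology_refinement (Suc 0) \<U> \<V>
    \<in> hom (cover_cohomology \<U> (Suc 0)) (cover_cohomology \<V> (Suc 0))"
proof -
  obtain \<rho> where \<rho>: "\<rho> \<in> refinement_maps \<U> \<V>"
    using refinement_maps_nonempty[OF assms] by blast
  note refinement = cohomology_refinement_class[OF _ \<rho>]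
  note mult = hom_mult[OF coho_class_hom, symmetric]
  show ?thesis
  proof (rule homI)
    fix x assume "x \<in> carrier (cover_cohomology \<U> (Suc 0))"
    then obtain c where c: "c \<in> cocycles \<U> (Suc 0)" "x = coho_class \<U> c"
      unfolding carrier_cover_cohomology by blast
    show "cohomology_refinement (Suc 0) \<U> \<V> x \<in> carrier (cover_cohomology \<V> (Suc 0))"
      unfolding c(2) refinement[OF c(1)] carrier_cover_cohomology
      by (rule imageI[OF cochain_pullback_cocycle[OF c(1) \<rho>]])
    fix y assume "y \<in> carrier (cover_cohomology \<U> (Suc 0))"
    then obtain d where d: "d \<in> cocycles \<U> (Suc 0)" "y = coho_class \<U> d"
      unfolding carrier_cover_cohomology by blast
    have cd: "c \<otimes>\<^bsub>cochain_group \<U> (Suc 0)\<^esub> d \<in> cocycles \<U> (Suc 0)"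
      by (intro subgroup.m_closed[OF cocycles_subgroup] c d)
    have "x \<otimes>\<^bsub>cover_cohomology \<U> (Suc 0)\<^esub> y = coho_class \<U> (c \<otimes>\<^bsub>cochain_group \<U> (Suc 0)\<^esub> d)"
      using mult[of c \<U> d] c d by simp
    moreover have "coho_class \<V> (cochain_pullback \<V> (Suc 0) \<rho> (c \<otimes>\<^bsub>cochain_group \<U> (Suc 0)\<^esub> d))
      = coho_class \<V> (cochain_pullback \<V> (Suc 0) \<rho> c) \<otimes>\<^bsub>cover_cohomology \<V> (Suc 0)\<^esub>
        coho_class \<V> (cochain_pullback \<V> (Suc 0) \<rho> d)"
      using mult[of "cochain_pullback \<V> (Suc 0) \<rho> c" \<V> "cochain_pullback \<V> (Suc 0) \<rho> d"]
        cochain_pullback_cocycle[OF c(1) \<rho>] cochain_pullback_cocycle[OF d(1) \<rho>]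
      by (simp add: cochain_pullback_mult[OF \<rho>])
    ultimately show "cohomology_refinement (Suc 0) \<U> \<V> (x \<otimes>\<^bsub>cover_cohomology \<U> (Suc 0)\<^esub> y) =
      cohomology_refinement (Suc 0) \<U> \<V> x \<otimes>\<^bsub>cover_cohomology \<V> (Suc 0)\<^esub>
      cohomology_refinement (Suc 0) \<U> \<V> y"
      by (simp only: refinement[OF cd] c(2) d(2) refinement[OF c(1)] refinement[OF d(1)])
  qed
qed

lemma cohomology_refinement_compose:
  assumes "refines \<V> \<U>" "refines \<W> \<V>" "x \<in> carrier (cover_cohomology \<U> (Suc 0))"
  shows "cohomology_refinement (Suc 0) \<V> \<W> (cohomology_refinement (Suc 0) \<U> \<V> x)
    = cohomology_refinement (Suc 0) \<U> \<W> x"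
proof -
  obtain \<rho> where \<rho>: "\<rho> \<in> refinement_maps \<U> \<V>"
    using refinement_maps_nonempty[OF assms(1)] by blast
  obtain \<sigma> where \<sigma>: "\<sigma> \<in> refinement_maps \<V> \<W>"
    using refinement_maps_nonempty[OF assms(2)] by blast
  obtain c where c: "c \<in> cocycles \<U> (Suc 0)" "x = coho_class \<U> c"
    using assms(3) unfolding carrier_cover_cohomology by blast
  have "cochain_pullback \<W> (Suc 0) \<sigma> (cochain_pullback \<V> (Suc 0) \<rho> c)
    = cochain_pullback \<W> (Suc 0) (\<rho> \<circ> \<sigma>) c"
  proof (rule extensionalityI[OF cochain_pullback_extensional cochain_pullback_extensional])
    fix s assume "s \<in> nerve \<W> (Suc 0)"
    then obtain A B where AB: "A \<in> \<W>" "B \<in> \<W>" "A \<inter> B \<noteq> {}" and s: "s = [A, B]"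
      unfolding mem_nerve_1 by metis
    obtain y where "y \<in> A" "y \<in> B"
      using AB(3) by auto
    then have y: "y \<in> \<sigma> A" "y \<in> \<sigma> B" "\<sigma> A \<in> \<V>" "\<sigma> B \<in> \<V>"
      using AB refinement_mapsD[OF \<sigma>] by blast+
    then have "\<sigma> A \<inter> \<sigma> B \<noteq> {}"
      by blast
    then show "cochain_pullback \<W> (Suc 0) \<sigma> (cochain_pullback \<V> (Suc 0) \<rho> c) s
      = cochain_pullback \<W> (Suc 0) (\<rho> \<circ> \<sigma>) c s"
      using y unfolding s cochain_pullback_values[OF AB]
      by (subst cochain_pullback_values) simp_all
  qed
  then show ?thesis
    unfolding c(2) cohomology_refinement_class[OF c(1) \<rho>]
      cohomology_refinement_class[OF cochain_pullback_cocycle[OF c(1) \<rho>] \<sigma>]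
      cohomology_refinement_class[OF c(1) refinement_maps_compose[OF \<rho> \<sigma>]]
    by (rule arg_cong)
qed

lemma common_refinement:
  assumes "open_cover X \<U>" "open_cover X \<V>"
  shows "\<exists>\<W>. open_cover X \<W> \<and> refines \<W> \<U> \<and> refines \<W> \<V>"
proof (intro exI conjI)
  let ?W = "{U \<inter> V |U V. U \<in> \<U> \<and> V \<in> \<V>}"
  have "\<Union>?W = \<Union>\<U> \<inter> \<Union>\<V>"
    by blast
  then show "open_cover X ?W"
    using assms unfolding open_cover_def by auto
  show "refines ?W \<U>" "refines ?W \<V>"
    unfolding refines_def by blast+
qed

lemma direct_system_cover_cohomology:
  "direct_system {\<U>. open_cover X \<U>} (\<lambda>\<U> \<V>. refines \<V> \<U>)
     (\<lambda>\<U>. cover_cohomology \<U> (Suc 0)) (cohomology_refinement (Suc 0))"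
proof (rule direct_system.intro, unfold mem_Collect_eq)
  show "{\<U>. open_cover X \<U>} \<noteq> {}"
  proof -
    have "open_cover X {topspace X}"
      by (simp add: open_cover_def)
    then show ?thesis by blast
  qed
  show "refines \<U> \<U>" for \<U> :: "'a set set"
    unfolding refines_def by blast
  show "refines \<W> \<U>" if "refines \<V> \<U>" "refines \<W> \<V>" for \<U> \<V> \<W> :: "'a set set"
    using that unfolding refines_def by (meson order_trans)
  show "\<exists>\<W>\<in>{\<U>. open_cover X \<U>}. refines \<W> \<U> \<and> refines \<W> \<V>"
    if "open_cover X \<U>" "open_cover X \<V>" for \<U> \<V>
    using common_refinement[OF that] by blast
qed (simp_all add: group_cover_cohomology cohomology_refinement_hom cohomology_refinement_compose)

text \<open>A root in the limit already exists over one refinement, and there equality of classes is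
  \<open>cohomologous1\<close>. The cohomology group enters the rest of the proof only in this
  form.\<close>

theorem divisible_by_cech_cohomology_iff:
  "divisible_by n (cech_cohomology 1 X) \<longleftrightarrow>
    (\<forall>\<U> c. open_cover X \<U> \<and> cocycle1 \<U> c \<longrightarrow>
      (\<exists>\<V> \<rho> d. open_cover X \<V> \<and> \<rho> \<in> refinement_maps \<U> \<V> \<and> cocycle1 \<V> d \<and>
         cohomologous1 \<V> (\<lambda>A B. c (\<rho> A) (\<rho> B)) (\<lambda>A B. int n * d A B)))"
    (is "_ \<longleftrightarrow> ?R")
proof -
  interpret direct_system "{\<U>. open_cover X \<U>}" "\<lambda>\<U> \<V>. refines \<V> \<U>"
    "\<lambda>\<U>. cover_cohomology \<U> (Suc 0)" "cohomology_refinement (Suc 0)"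
    by (rule direct_system_cover_cohomology)
  \<comment> \<open>The left side does not mention \<open>\<rho>\<close>, so any refinement map may
    be used on the right.\<close>
  have root_iff: "cohomology_refinement (Suc 0) \<U> \<V> (coho_class \<U> c)
        = coho_class \<V> d [^]\<^bsub>cover_cohomology \<V> (Suc 0)\<^esub> n
      \<longleftrightarrow> cohomologous1 \<V> (\<lambda>A B. c [\<rho> A, \<rho> B]) (\<lambda>A B. int n * d [A, B])"
    if c: "c \<in> cocycles \<U> (Suc 0)" and \<rho>: "\<rho> \<in> refinement_maps \<U> \<V>" and d: "d \<in> cocycles \<V> (Suc 0)"
    for \<U> \<V> c d \<rho>
  proof -
    have ext: "(\<lambda>s\<in>nerve \<V> (Suc 0). int n * d s) \<in> extensional (nerve \<V> (Suc 0))"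
      by simp
    show ?thesis
      unfolding cohomology_refinement_class[OF c \<rho>] coho_class_pow[OF d]
        coho_class_eq_iff[OF cochain_pullback_extensional ext]
      by (rule iffI; erule cohomologous1_cong)
        (subst cochain_pullback_values, assumption+, rule refl | simp add: mem_nerve_1)+
  qed
  have "divisible_by n (cech_cohomology 1 X) \<longleftrightarrow>
      (\<forall>\<U>\<in>{\<U>. open_cover X \<U>}. \<forall>x\<in>carrier (cover_cohomology \<U> (Suc 0)).
         \<exists>\<V>\<in>{\<U>. open_cover X \<U>}. refines \<V> \<U> \<and>
           (\<exists>y\<in>carrier (cover_cohomology \<V> (Suc 0)).
             cohomology_refinement (Suc 0) \<U> \<V> x = y [^]\<^bsub>cover_cohomology \<V> (Suc 0)\<^esub> n))"
    unfolding cech_cohomology_def One_nat_def by (rule divisible_by_direct_limit_iff)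
  also have "\<dots> \<longleftrightarrow> (\<forall>\<U>. open_cover X \<U> \<longrightarrow> (\<forall>c\<in>cocycles \<U> (Suc 0). \<exists>\<V>. open_cover X \<V> \<and> refines \<V> \<U> \<and>
      (\<exists>d\<in>cocycles \<V> (Suc 0). cohomology_refinement (Suc 0) \<U> \<V> (coho_class \<U> c)
         = coho_class \<V> d [^]\<^bsub>cover_cohomology \<V> (Suc 0)\<^esub> n)))"
    unfolding carrier_cover_cohomology ball_simps bex_simps by (simp only: mem_Collect_eq Ball_def Bex_def)
  also have "\<dots> \<longleftrightarrow> ?R"
  proof (intro iffI allI impI ballI)
    fix \<U> c
    assume L: "\<forall>\<U>. open_cover X \<U> \<longrightarrow> (\<forall>c\<in>cocycles \<U> (Suc 0). \<exists>\<V>. open_cover X \<V> \<and> refines \<V> \<U> \<and>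
      (\<exists>d\<in>cocycles \<V> (Suc 0). cohomology_refinement (Suc 0) \<U> \<V> (coho_class \<U> c)
         = coho_class \<V> d [^]\<^bsub>cover_cohomology \<V> (Suc 0)\<^esub> n))"
      and Uc: "open_cover X \<U> \<and> cocycle1 \<U> c"
    have c: "pair_cochain \<U> c \<in> cocycles \<U> (Suc 0)"
      using Uc by (intro pair_cochain_cocycle) simp
    then obtain \<V> d where V: "open_cover X \<V>" "refines \<V> \<U>" and d: "d \<in> cocycles \<V> (Suc 0)"
      and eq: "cohomology_refinement (Suc 0) \<U> \<V> (coho_class \<U> (pair_cochain \<U> c))
         = coho_class \<V> d [^]\<^bsub>cover_cohomology \<V> (Suc 0)\<^esub> n"
      using L Uc by blast
    obtain \<rho> where \<rho>: "\<rho> \<in> refinement_maps \<U> \<V>"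
      using refinement_maps_nonempty[OF V(2)] by blast
    have *: "c (\<rho> A) (\<rho> B) = pair_cochain \<U> c [\<rho> A, \<rho> B]"
      if AB: "A \<in> \<V>" "B \<in> \<V>" "A \<inter> B \<noteq> {}" for A B
    proof (rule pair_values_pair_cochain[symmetric])
      show "\<rho> A \<inter> \<rho> B \<noteq> {}"
        using AB(3) refinement_mapsD(2)[OF \<rho> AB(1)] refinement_mapsD(2)[OF \<rho> AB(2)] by blast
    qed (use AB refinement_mapsD(1)[OF \<rho>] in auto)
    have "cohomologous1 \<V> (\<lambda>A B. c (\<rho> A) (\<rho> B)) (\<lambda>A B. int n * d [A, B])"
      using eq unfolding root_iff[OF c \<rho> d] by (rule cohomologous1_cong) (rule *, assumption+, rule refl)
    then show "\<exists>\<V> \<rho> d. open_cover X \<V> \<and> \<rho> \<in> refinement_maps \<U> \<V> \<and> cocycle1 \<V> d \<and>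
         cohomologous1 \<V> (\<lambda>A B. c (\<rho> A) (\<rho> B)) (\<lambda>A B. int n * d A B)"
      using V(1) \<rho> d unfolding cocycles_iff by (intro exI conjI) auto
  next
    fix \<U> c
    assume R: ?R and U: "open_cover X \<U>" and c: "c \<in> cocycles \<U> (Suc 0)"
    have "cocycle1 \<U> (pair_values c)"
      using c by (simp add: cocycles_iff)
    then obtain \<V> \<rho> d where V: "open_cover X \<V>" and \<rho>: "\<rho> \<in> refinement_maps \<U> \<V>" and d: "cocycle1 \<V> d"
      and coh: "cohomologous1 \<V> (\<lambda>A B. c [\<rho> A, \<rho> B]) (\<lambda>A B. int n * d A B)"
      using mp[OF spec[OF spec[OF R, of \<U>], of "pair_values c"]] U by auto
    have "cohomologous1 \<V> (\<lambda>A B. c [\<rho> A, \<rho> B]) (\<lambda>A B. int n * pair_cochain \<V> d [A, B])"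
      using coh by (rule cohomologous1_cong) (rule refl, simp add: mem_nerve_1)
    moreover have "refines \<V> \<U>"
      using \<rho> unfolding refinement_maps_def refines_def by blast
    ultimately show "\<exists>\<V>. open_cover X \<V> \<and> refines \<V> \<U> \<and>
      (\<exists>d\<in>cocycles \<V> (Suc 0). cohomology_refinement (Suc 0) \<U> \<V> (coho_class \<U> c)
         = coho_class \<V> d [^]\<^bsub>cover_cohomology \<V> (Suc 0)\<^esub> n)"
      using V pair_cochain_cocycle[OF d] root_iff[OF c \<rho> pair_cochain_cocycle[OF d]] by blast
  qed
  finally show ?thesis .
qed

section \<open>Cocycles and roots of circle-valued functions\<close>

text \<open>Angles are measured in full turns, so that two angles of the same point differ by an
  integer, the possible value of a cocycle.\<close>

lemma cis_two_pi_eq_iff: "cis (2 * pi * a) = cis (2 * pi * b) \<longleftrightarrow> a - b \<in> \<int>"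
proof -
  have "cis (2 * pi * a) = cis (2 * pi * b) \<longleftrightarrow> cis (2 * pi * (a - b)) = 1"
    by (simp add: right_diff_distrib flip: cis_divide)
  also have "\<dots> \<longleftrightarrow> (\<exists>m. a - b = of_int m)"
    unfolding cis_eq_1_iff mult.commute[of "2 * pi"] mult_cancel_right by simp
  also have "\<dots> \<longleftrightarrow> a - b \<in> \<int>"
    by (auto elim: Ints_cases)
  finally show ?thesis .
qed

lemma continuous_map_complex_mult:
  fixes f g :: "'a \<Rightarrow> complex"
  shows "\<lbrakk>continuous_map X euclidean f; continuous_map X euclidean g\<rbrakk>
    \<Longrightarrow> continuous_map X euclidean (\<lambda>x. f x * g x)"
  by (simp add: continuous_map_atin tendsto_mult)

lemma continuous_map_continuous_on_compose:
  assumes "continuous_map X euclidean f" "continuous_on S \<phi>" "\<And>x. x \<in> topspace X \<Longrightarrow> f x \<in> S"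
  shows "continuous_map X euclidean (\<lambda>x. \<phi> (f x))"
proof -
  have "continuous_map X (top_of_set S) f"
    using assms(1,3) by (auto simp: continuous_map_in_subtopology)
  moreover have "continuous_map (top_of_set S) euclidean \<phi>"
    using assms(2) by (simp add: continuous_map_iff_continuous)
  ultimately have "continuous_map X euclidean (\<phi> \<circ> f)"
    by (rule continuous_map_compose)
  then show ?thesis by (simp add: o_def)
qed

text \<open>Stands in for \<open>n\<close>-divisibility of [X, S^1]. Exact roots exist as soon as
  roots up to homotopy do, because a circle-valued function homotopic to 1 has a continuous
  logarithm, and an \<open>n\<close>-th of it corrects the root. For \<open>n > 0\<close> the values
  of \<open>g\<close> lie on the circle automatically.\<close>

definition circle_root_closed :: "nat \<Rightarrow> 'a topology \<Rightarrow> bool" where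
  "circle_root_closed n X \<longleftrightarrow>
     (\<forall>f. continuous_map X euclidean f \<and> (\<forall>x\<in>topspace X. norm (f x) = 1) \<longrightarrow>
       (\<exists>g. continuous_map X euclidean g \<and> (\<forall>x\<in>topspace X. g x ^ n = (f x :: complex))))"

lemma circle_root_closedE:
  assumes "circle_root_closed n X" "continuous_map X euclidean f" "\<And>x. x \<in> topspace X \<Longrightarrow> norm (f x) = 1"
  obtains g :: "'a \<Rightarrow> complex" where "continuous_map X euclidean g" "\<And>x. x \<in> topspace X \<Longrightarrow> g x ^ n = f x"
  using assms by (auto simp: circle_root_closed_def)

text \<open>Over the sheaf of continuous real functions every cocycle is a coboundary.\<close>

lemma cocycle1_real_coboundary:
  assumes X: "Hausdorff_space X" "paracompact_space X"
    and \<U>: "open_cover X \<U>" and c: "cocycle1 \<U> c"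
  obtains \<V> \<rho> h where "open_cover X \<V>" "\<rho> \<in> refinement_maps \<U> \<V>"
    and "\<And>A. A \<in> \<V> \<Longrightarrow> continuous_map X euclideanreal (h A)"
    and "\<And>A B x. \<lbrakk>A \<in> \<V>; B \<in> \<V>; x \<in> A; x \<in> B\<rbrakk> \<Longrightarrow> h B x - h A x = of_int (c (\<rho> A) (\<rho> B))"
proof -
  obtain \<V> \<psi> where V: "open_cover X \<V>" "refines \<V> \<U>" "locally_finite_in X \<V>"
    and cont: "\<And>A. A \<in> \<V> \<Longrightarrow> continuous_map X euclideanreal (\<psi> A)"
    and nonneg: "\<And>A x. \<lbrakk>A \<in> \<V>; x \<in> topspace X\<rbrakk> \<Longrightarrow> 0 \<le> \<psi> A x"
    and zero: "\<And>A x. \<lbrakk>A \<in> \<V>; x \<in> topspace X; x \<notin> A\<rbrakk> \<Longrightarrow> \<psi> A x = 0"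
    and pos: "\<And>x. x \<in> topspace X \<Longrightarrow> \<exists>A\<in>\<V>. 0 < \<psi> A x"
    by (rule paracompact_bump_functions[OF X \<U>]) blast
  obtain \<rho> where \<rho>: "\<rho> \<in> refinement_maps \<U> \<V>"
    using refinement_maps_nonempty[OF V(2)] by blast
  define S where "S x = (\<Sum>A | A \<in> \<V> \<and> x \<in> A. \<psi> A x)" for x
  \<comment> \<open>The average, with weights \<open>\<psi> A x / S x\<close>, of the jumps to
    \<open>B\<close> from the sets \<open>A\<close> around \<open>x\<close>. Off \<open>B\<close>
    the integers involved may be arbitrary, yet \<open>h B\<close> is continuous on all of
    \<open>X\<close>.\<close>
  define h where "h B x = (\<Sum>A | A \<in> \<V> \<and> x \<in> A. \<psi> A x * of_int (c (\<rho> A) (\<rho> B))) / S x" for B x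
  have S_pos: "0 < S x" if x: "x \<in> topspace X" for x
  proof -
    obtain A where A: "A \<in> \<V>" "0 < \<psi> A x"
      using pos[OF x] by metis
    then have "x \<in> A"
      using zero[OF A(1) x] by force
    then show ?thesis
      unfolding S_def using A nonneg x locally_finite_in_finite_at[OF V(3) x]
      by (intro sum_pos2[of _ A]) auto
  qed
  have S_cont: "continuous_map X euclideanreal S"
    unfolding S_def using cont zero by (rule continuous_map_locally_finite_sum[OF V(3)])
  have h_cont: "continuous_map X euclideanreal (h B)" for B
    unfolding h_def
  proof (intro continuous_map_real_divide continuous_map_locally_finite_sum[OF V(3)] S_cont)
    show "continuous_map X euclideanreal (\<lambda>x. \<psi> A x * of_int (c (\<rho> A) (\<rho> B)))" if "A \<in> \<V>" for A
      using cont[OF that] by (intro continuous_map_real_mult) auto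
  qed (use zero S_pos in force)+
  have h_diff: "h B x - h A x = of_int (c (\<rho> A) (\<rho> B))" if AB: "A \<in> \<V>" "B \<in> \<V>" "x \<in> A" "x \<in> B" for A B x
  proof -
    have x: "x \<in> topspace X"
      using V(1) AB unfolding open_cover_def by blast
    \<comment> \<open>The jump from \<open>C\<close> to \<open>B\<close> splits at \<open>A\<close>;
      the part from \<open>A\<close> to \<open>B\<close> does not depend on \<open>C\<close>, so its
      average is itself.\<close>
    have "(\<Sum>C | C \<in> \<V> \<and> x \<in> C. \<psi> C x * of_int (c (\<rho> C) (\<rho> B)))
        = (\<Sum>C | C \<in> \<V> \<and> x \<in> C. \<psi> C x * of_int (c (\<rho> C) (\<rho> A)) + \<psi> C x * of_int (c (\<rho> A) (\<rho> B)))"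
    proof (rule sum.cong[OF refl])
      fix C assume "C \<in> {C. C \<in> \<V> \<and> x \<in> C}"
      then have C: "C \<in> \<V>" "x \<in> C"
        by auto
      have "x \<in> \<rho> C \<inter> \<rho> A \<inter> \<rho> B"
        using refinement_mapsD(2)[OF \<rho>] C AB by simp
      then have "c (\<rho> C) (\<rho> B) = c (\<rho> C) (\<rho> A) + c (\<rho> A) (\<rho> B)"
        using refinement_mapsD(1)[OF \<rho>] C AB by (intro cocycle1D[OF c]) auto
      then show "\<psi> C x * of_int (c (\<rho> C) (\<rho> B))
          = \<psi> C x * of_int (c (\<rho> C) (\<rho> A)) + \<psi> C x * of_int (c (\<rho> A) (\<rho> B))"
        by (simp add: algebra_simps)
    qed
    also have "\<dots> = (\<Sum>C | C \<in> \<V> \<and> x \<in> C. \<psi> C x * of_int (c (\<rho> C) (\<rho> A))) + S x * of_int (c (\<rho> A) (\<rho> B))"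
      by (simp add: sum.distrib S_def sum_distrib_right)
    finally show ?thesis
      using S_pos[OF x] by (simp add: h_def field_simps)
  qed
  show thesis
    by (rule that[OF V(1) \<rho> h_cont h_diff])
qed

text \<open>On each set of the cover the root is \<open>exp (2 pi i (h + k) / n)\<close> with
  \<open>k\<close> locally constant modulo \<open>n\<close>. Once the cover is refined by the values
  of \<open>k\<close>, two such expressions agree on overlaps, so the jump of \<open>h + k\<close>
  is a multiple of \<open>n\<close>, while the jump of \<open>k\<close> alone is a
  coboundary.\<close>

lemma circle_root_closed_imp_cocycle_divisible:
  assumes X: "Hausdorff_space X" "paracompact_space X" and n: "n > 0"
    and root: "circle_root_closed n X" and \<U>: "open_cover X \<U>" and c: "cocycle1 \<U> c"
  shows "\<exists>\<V> \<rho> d. open_cover X \<V> \<and> \<rho> \<in> refinement_maps \<U> \<V> \<and> cocycle1 \<V> d \<and>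
    cohomologous1 \<V> (\<lambda>A B. c (\<rho> A) (\<rho> B)) (\<lambda>A B. int n * d A B)"
proof -
  obtain \<V> \<rho> h where V: "open_cover X \<V>" and \<rho>: "\<rho> \<in> refinement_maps \<U> \<V>"
    and h_cont: "\<And>A. A \<in> \<V> \<Longrightarrow> continuous_map X euclideanreal (h A)"
    and h_diff: "\<And>A B x. \<lbrakk>A \<in> \<V>; B \<in> \<V>; x \<in> A; x \<in> B\<rbrakk> \<Longrightarrow> h B x - h A x = of_int (c (\<rho> A) (\<rho> B))"
    by (rule cocycle1_real_coboundary[OF X \<U> c]) blast
  have cis_cont: "continuous_map X euclidean (\<lambda>x. cis (a * h A x))" if "A \<in> \<V>" for a A
    by (rule continuous_map_continuous_on_compose[where S = UNIV])
      (use h_cont[OF that] in \<open>auto intro!: continuous_intros continuous_map_real_mult\<close>)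
  obtain f where f_cont: "continuous_map X euclidean f"
    and f: "\<And>x A. \<lbrakk>A \<in> \<V>; x \<in> topspace X \<inter> A\<rbrakk> \<Longrightarrow> f x = cis (2 * pi * h A x)"
  proof (rule pasting_lemma_exists[where X = X and Y = euclidean and I = \<V> and T = id and
        f = "\<lambda>A x. cis (2 * pi * h A x)"])
    show "cis (2 * pi * h A x) = cis (2 * pi * h B x)"
      if "A \<in> \<V>" "B \<in> \<V>" "x \<in> topspace X \<inter> id A \<inter> id B" for A B x
      unfolding cis_two_pi_eq_iff using h_diff[of B A x] that by simp
    show "continuous_map (subtopology X (id A)) euclidean (\<lambda>x. cis (2 * pi * h A x))"
      if "A \<in> \<V>" for A
      by (rule continuous_map_from_subtopology[OF cis_cont[OF that]])
  qed (use V in \<open>simp_all add: open_cover_def\<close>)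
  have "norm (f x) = 1" if x: "x \<in> topspace X" for x
  proof -
    obtain A where "A \<in> \<V>" "x \<in> A"
      using x V unfolding open_cover_def by blast
    then show ?thesis
      using f[of A x] x by simp
  qed
  then obtain g where g_cont: "continuous_map X euclidean g"
    and g: "\<And>x. x \<in> topspace X \<Longrightarrow> g x ^ n = f x"
    using circle_root_closedE[OF root f_cont] by metis

  \<comment> \<open>The root \<open>g\<close> divided by the local root that the logarithm
    \<open>h A\<close> provides; on \<open>A\<close> its values are \<open>n\<close>-th roots of
    unity.\<close>
  define u where "u A x = g x * cis (- (2 * pi / n) * h A x)" for A x
  have u_cont: "continuous_map X euclidean (u A)" if "A \<in> \<V>" for A
    unfolding u_def using g_cont cis_cont[OF that] by (rule continuous_map_complex_mult)
  have u_root: "u A x ^ n = 1" if "A \<in> \<V>" "x \<in> A" for A x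
  proof -
    have x: "x \<in> topspace X"
      using that V unfolding open_cover_def by blast
    have "u A x ^ n = f x * cis (real n * (- (2 * pi / n) * h A x))"
      by (simp only: u_def power_mult_distrib g[OF x] Complex.DeMoivre)
    also have "\<dots> = f x * cis (- (2 * pi) * h A x)"
      using n by simp
    also have "\<dots> = 1"
      using f[of A x] that x by (simp add: cis_mult)
    finally show ?thesis .
  qed
  define R where "R = {z::complex. z ^ n = 1}"
  define \<omega> where "\<omega> k = cis (2 * pi * real k / real n)" for k
  have R: "bij_betw \<omega> {..<n} R"
    unfolding R_def \<omega>_def by (rule Complex.bij_betw_roots_unity[OF n])
  have "finite R"
    using bij_betw_finite[OF R] by simp
  txt \<open>The sheet of the root over \<open>A\<close> on which it is \<open>exp (2 \<pi> i (h A + k) / n)\<close>. Removing the other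
    roots of unity, a closed set, makes its openness evident.\<close>
  define P where "P A k = {x \<in> A. u A x \<in> - (R - {\<omega> k})}" for A k
  have P_value: "u A x = \<omega> k" if "A \<in> \<V>" "x \<in> P A k" for A k x
    using that u_root unfolding P_def R_def by blast
  define \<W> where "\<W> = {P A k |A k. A \<in> \<V> \<and> k < n}"
  have W: "open_cover X \<W>"
    unfolding open_cover_def
  proof (intro conjI ballI subset_antisym subsetI)
    fix x assume x: "x \<in> topspace X"
    then obtain A where A: "A \<in> \<V>" "x \<in> A"
      using V unfolding open_cover_def by blast
    then have "u A x \<in> \<omega> ` {..<n}"
      using u_root bij_betw_imp_surj_on[OF R] unfolding R_def by blast
    then obtain k where "k < n" "u A x = \<omega> k"
      by auto
    then have "x \<in> P A k" "P A k \<in> \<W>"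
      using A unfolding P_def \<W>_def by blast+
    then show "x \<in> \<Union>\<W>"
      by blast
  next
    fix x assume "x \<in> \<Union>\<W>"
    then obtain A where "A \<in> \<V>" "x \<in> A"
      unfolding \<W>_def P_def by blast
    then show "x \<in> topspace X"
      using V unfolding open_cover_def by blast
  next
    fix B assume "B \<in> \<W>"
    then obtain A k where A: "A \<in> \<V>" and B: "B = P A k"
      unfolding \<W>_def by blast
    show "openin X B"
      unfolding B P_def
    proof (rule openin_continuous_map_preimage_gen[OF u_cont[OF A]])
      show "openin X A"
        using A V unfolding open_cover_def by blast
      have "open (- (R - {\<omega> k}))"
        by (intro open_Compl finite_imp_closed finite_Diff \<open>finite R\<close>)
      then show "openin euclidean (- (R - {\<omega> k}))"
        by (simp only: open_openin)
    qed
  qed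
  \<comment> \<open>The same set, for instance the empty one, may be a sheet for several pairs; one
    pair is fixed for each.\<close>
  have "\<exists>A k. A \<in> \<V> \<and> B = P A k" if "B \<in> \<W>" for B
    using that unfolding \<W>_def by blast
  then obtain \<alpha> \<kappa> where \<alpha>: "\<And>B. B \<in> \<W> \<Longrightarrow> \<alpha> B \<in> \<V> \<and> B = P (\<alpha> B) (\<kappa> B)"
    by metis
  have \<alpha>_map: "\<alpha> \<in> refinement_maps \<V> \<W>"
    unfolding refinement_maps_def
  proof (intro CollectI ballI conjI)
    fix B assume "B \<in> \<W>"
    then show "\<alpha> B \<in> \<V>" "B \<subseteq> \<alpha> B"
      using \<alpha>[of B] unfolding P_def by blast+
  qed
  \<comment> \<open>The jump of \<open>h + \<kappa>\<close>. It is cohomologous to the pulled back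
    \<open>c\<close>, and divisible by \<open>n\<close> on overlaps because both sides describe the
    same value of \<open>g\<close>.\<close>
  define t where "t A B = c (\<rho> (\<alpha> A)) (\<rho> (\<alpha> B)) + int (\<kappa> B) - int (\<kappa> A)" for A B
  have t_dvd: "int n dvd t A B" if AB: "A \<in> \<W>" "B \<in> \<W>" "A \<inter> B \<noteq> {}" for A B
  proof -
    obtain x where x: "x \<in> A" "x \<in> B"
      using AB(3) by blast
    have g_eq: "g x = cis (2 * pi * ((h (\<alpha> C) x + \<kappa> C) / n))" if C: "C \<in> \<W>" "x \<in> C" for C
    proof -
      have "u (\<alpha> C) x = \<omega> (\<kappa> C)"
        using \<alpha>[OF C(1)] C(2) by (intro P_value) auto
      then have "g x = \<omega> (\<kappa> C) / cis (- (2 * pi / n) * h (\<alpha> C) x)"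
        by (simp add: u_def field_simps)
      also have "\<dots> = cis (2 * pi * ((h (\<alpha> C) x + \<kappa> C) / n))"
        unfolding \<omega>_def cis_divide
        by (rule arg_cong[of _ _ cis]) (simp add: add_divide_distrib algebra_simps)
      finally show ?thesis .
    qed
    have "(h (\<alpha> B) x + \<kappa> B) / n - (h (\<alpha> A) x + \<kappa> A) / n \<in> \<int>"
      using g_eq[OF AB(1) x(1)] g_eq[OF AB(2) x(2)] cis_two_pi_eq_iff by metis
    then obtain m where m: "(h (\<alpha> B) x + \<kappa> B) / n - (h (\<alpha> A) x + \<kappa> A) / n = of_int m"
      by (auto elim: Ints_cases)
    have m': "(h (\<alpha> B) x + \<kappa> B) - (h (\<alpha> A) x + \<kappa> A) = of_int m * n"
      using m n by (simp add: nonzero_divide_eq_eq flip: diff_divide_distrib)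
    have "x \<in> \<alpha> A" "x \<in> \<alpha> B" "\<alpha> A \<in> \<V>" "\<alpha> B \<in> \<V>"
      using refinement_mapsD[OF \<alpha>_map] AB x by auto
    then have "h (\<alpha> B) x - h (\<alpha> A) x = of_int (c (\<rho> (\<alpha> A)) (\<rho> (\<alpha> B)))"
      by (intro h_diff)
    then have "real_of_int (t A B) = real_of_int (int n * m)"
      using m' by (simp add: t_def mult.commute)
    then show ?thesis
      by (metis dvd_triv_left of_int_eq_iff)
  qed
  define d where "d A B = t A B div int n" for A B
  have nd: "int n * d A B = t A B" if "A \<in> \<W>" "B \<in> \<W>" "A \<inter> B \<noteq> {}" for A B
    using t_dvd[OF that] by (simp add: d_def)
  have \<rho>\<alpha>: "\<rho> \<circ> \<alpha> \<in> refinement_maps \<U> \<W>"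
    by (rule refinement_maps_compose[OF \<rho> \<alpha>_map])
  have c': "cocycle1 \<W> (\<lambda>A B. c ((\<rho> \<circ> \<alpha>) A) ((\<rho> \<circ> \<alpha>) B))"
    by (rule cocycle1_pullback[OF c \<rho>\<alpha>])
  have "cocycle1 \<W> d"
    unfolding cocycle1_def
  proof (intro ballI impI)
    fix A B C assume ABC: "A \<in> \<W>" "B \<in> \<W>" "C \<in> \<W>" "A \<inter> B \<inter> C \<noteq> {}"
    then have "A \<inter> B \<noteq> {}" "B \<inter> C \<noteq> {}" "A \<inter> C \<noteq> {}"
      by auto
    then have "int n * d A C = int n * (d A B + d B C)"
      using cocycle1D[OF c' ABC] nd[of A B] nd[of B C] nd[of A C] ABC(1-3)
      by (simp add: t_def distrib_left)
    then show "d A C = d A B + d B C"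
      using n by simp
  qed
  moreover have "cohomologous1 \<W> (\<lambda>A B. c ((\<rho> \<circ> \<alpha>) A) ((\<rho> \<circ> \<alpha>) B)) (\<lambda>A B. int n * d A B)"
    unfolding cohomologous1_def
  proof (rule exI[of _ "\<lambda>A. - int (\<kappa> A)"], intro ballI impI)
    fix A B assume "A \<in> \<W>" "B \<in> \<W>" "A \<inter> B \<noteq> {}"
    then show "c ((\<rho> \<circ> \<alpha>) A) ((\<rho> \<circ> \<alpha>) B) = int n * d A B + - int (\<kappa> B) - - int (\<kappa> A)"
      using nd[of A B] by (simp add: t_def)
  qed
  ultimately show ?thesis
    using W \<rho>\<alpha> by (intro exI conjI)
qed

text \<open>Overlaps need not be connected, so the jumps of arbitrary logarithms would only be
  locally constant. Pieces on which \<open>f\<close> stays in an open half plane bound the variation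
  of each branch, and the jump becomes constant on every overlap.\<close>

lemma cocycle_divisible_imp_circle_root_closed:
  assumes n: "n > 0"
    and div: "\<And>\<U> c. \<lbrakk>open_cover X \<U>; cocycle1 \<U> c\<rbrakk> \<Longrightarrow>
      \<exists>\<V> \<rho> d. open_cover X \<V> \<and> \<rho> \<in> refinement_maps \<U> \<V> \<and> cocycle1 \<V> d \<and>
        cohomologous1 \<V> (\<lambda>A B. c (\<rho> A) (\<rho> B)) (\<lambda>A B. int n * d A B)"
  shows "circle_root_closed n X"
  unfolding circle_root_closed_def
proof (intro allI impI, elim conjE)
  fix f :: "'a \<Rightarrow> complex"
  assume f_cont: "continuous_map X euclidean f" and f_norm: "\<forall>x\<in>topspace X. norm (f x) = 1"
  \<comment> \<open>The points where \<open>f\<close> is less than a quarter turn away from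
    \<open>t\<close>; there \<open>f x / t\<close> avoids the branch cut of
    \<open>Ln\<close>.\<close>
  define S where "S t = {x \<in> topspace X. f x / t \<in> {z. 0 < Re z}}" for t
  define \<U> where "\<U> = S ` {t. norm t = 1}"
  have S_open: "openin X (S t)" if "norm t = 1" for t
  proof -
    have "t \<noteq> 0"
      using that by auto
    then have "continuous_map X euclidean (\<lambda>x. f x / t)"
      by (intro continuous_map_continuous_on_compose[OF f_cont, where S = UNIV] continuous_intros) auto
    moreover have "openin euclidean {z::complex. 0 < Re z}"
      by (simp add: open_halfspace_Re_gt)
    ultimately show ?thesis
      unfolding S_def by (rule openin_continuous_map_preimage)
  qed
  have \<U>: "open_cover X \<U>"
    unfolding open_cover_def
  proof (intro conjI ballI subset_antisym subsetI)
    fix x assume x: "x \<in> topspace X"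
    then have "norm (f x) = 1"
      using f_norm by simp
    moreover from this have "x \<in> S (f x)"
      using x by (auto simp: S_def)
    ultimately show "x \<in> \<Union>\<U>"
      unfolding \<U>_def by blast
  qed (use S_open in \<open>auto simp: \<U>_def S_def\<close>)
  have "\<exists>t. norm t = 1 \<and> U = S t" if "U \<in> \<U>" for U
    using that unfolding \<U>_def by blast
  \<comment> \<open>Different directions may give the same set, so one is fixed for each member of
    the cover.\<close>
  then obtain t where t: "\<And>U. U \<in> \<U> \<Longrightarrow> norm (t U) = 1 \<and> U = S (t U)"
    by metis
  \<comment> \<open>The angle of \<open>f x\<close> in turns: that of \<open>t U\<close> plus the
    principal angle of the quotient, which is continuous on \<open>U\<close>.\<close>
  define \<theta> where "\<theta> U x = (Arg (t U) + Im (Ln (f x / t U))) / (2 * pi)" for U x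
  have pos: "0 < Re (f x / t U)" "x \<in> topspace X" "t U \<noteq> 0" "norm (f x / t U) = 1"
    if U: "U \<in> \<U>" "x \<in> U" for U x
  proof -
    have "x \<in> S (t U)"
      using t[OF U(1)] U(2) by simp
    then show "0 < Re (f x / t U)" and x: "x \<in> topspace X"
      unfolding S_def by simp_all
    show "t U \<noteq> 0"
      using t[OF U(1)] by auto
    show "norm (f x / t U) = 1"
      using t[OF U(1)] f_norm x by (simp add: norm_divide)
  qed
  have cis_\<theta>: "cis (2 * pi * \<theta> U x) = f x" if U: "U \<in> \<U>" "x \<in> U" for U x
  proof -
    have nz: "f x / t U \<noteq> 0"
      using pos(4)[OF U] by auto
    have "2 * pi * \<theta> U x = Arg (t U) + Arg (f x / t U)"
      by (simp add: \<theta>_def Arg_eq_Im_Ln[OF nz])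
    then have "cis (2 * pi * \<theta> U x) = cis (Arg (t U)) * cis (Arg (f x / t U))"
      by (simp add: cis_mult)
    also have "\<dots> = t U * (f x / t U)"
      unfolding cis_Arg[OF pos(3)[OF U]] cis_Arg[OF nz]
      using pos(4)[OF U] t[OF U(1)] by (simp add: sgn_eq)
    finally show ?thesis
      using pos(3)[OF U] by simp
  qed
  have \<theta>_near: "\<bar>\<theta> U x - Arg (t U) / (2 * pi)\<bar> < 1 / 4" if U: "U \<in> \<U>" "x \<in> U" for U x
  proof -
    have "f x / t U \<noteq> 0"
      using pos(4)[OF U] by auto
    then have "\<bar>Im (Ln (f x / t U))\<bar> < pi / 2"
      using Re_Ln_pos_lt pos(1)[OF U] by blast
    moreover have "\<theta> U x - Arg (t U) / (2 * pi) = Im (Ln (f x / t U)) / (2 * pi)"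
      by (simp add: \<theta>_def add_divide_distrib)
    ultimately show ?thesis
      by (simp add: abs_divide pos_divide_less_eq)
  qed
  have \<theta>_cont: "continuous_map (subtopology X U) euclideanreal (\<theta> U)" if U: "U \<in> \<U>" for U
    unfolding \<theta>_def
  proof (rule continuous_map_continuous_on_compose[where f = f and S = "{z. 0 < Re (z / t U)}"])
    show "continuous_map (subtopology X U) euclidean f"
      using f_cont by (rule continuous_map_from_subtopology)
    show "f x \<in> {z. 0 < Re (z / t U)}" if "x \<in> topspace (subtopology X U)" for x
      using that pos(1)[OF U] by simp
    have "t U \<noteq> 0"
      using t[OF U] by auto
    then show "continuous_on {z. 0 < Re (z / t U)} (\<lambda>z. (Arg (t U) + Im (Ln (z / t U))) / (2 * pi))"
      by (intro continuous_intros) (auto simp: complex_nonpos_Reals_iff)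
  qed
  \<comment> \<open>Any point of the overlap gives the same value, as the next fact shows; the floor
    only turns an integral real into an \<open>int\<close>.\<close>
  define c where "c U V = \<lfloor>\<theta> V (SOME x. x \<in> U \<inter> V) - \<theta> U (SOME x. x \<in> U \<inter> V)\<rfloor>" for U V
  have c: "of_int (c U V) = \<theta> V x - \<theta> U x" if UV: "U \<in> \<U>" "V \<in> \<U>" "x \<in> U" "x \<in> V" for U V x
  proof -
    define y where "y = (SOME x. x \<in> U \<inter> V)"
    have "y \<in> U \<inter> V"
      unfolding y_def by (rule someI[of _ x]) (use UV in simp)
    then have y: "y \<in> U" "y \<in> V"
      by auto
    have "\<theta> V z - \<theta> U z \<in> \<int>" if "z \<in> U" "z \<in> V" for z
      using cis_\<theta>[OF UV(1) that(1)] cis_\<theta>[OF UV(2) that(2)] cis_two_pi_eq_iff by metis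
    then obtain k l where k: "\<theta> V x - \<theta> U x = of_int k" and l: "\<theta> V y - \<theta> U y = of_int l"
      using UV y by (metis Ints_cases)
    txt \<open>Each branch stays within \<open>1/4\<close> of a constant, so the jump varies by less than \<open>1\<close>.\<close>
    have "\<bar>real_of_int k - real_of_int l\<bar> < 1"
      unfolding k[symmetric] l[symmetric]
      using \<theta>_near[OF UV(1,3)] \<theta>_near[OF UV(2,4)] \<theta>_near[OF UV(1) y(1)] \<theta>_near[OF UV(2) y(2)]
      by linarith
    then have "k = l"
      by linarith
    then show ?thesis
      unfolding c_def y_def[symmetric] l k by simp
  qed
  have "cocycle1 \<U> c"
    unfolding cocycle1_def
  proof (intro ballI impI)
    fix A B C assume ABC: "A \<in> \<U>" "B \<in> \<U>" "C \<in> \<U>" "A \<inter> B \<inter> C \<noteq> {}"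
    then obtain x where x: "x \<in> A" "x \<in> B" "x \<in> C"
      by blast
    have "real_of_int (c A C) = real_of_int (c A B + c B C)"
      using c[OF ABC(1,2) x(1,2)] c[OF ABC(2,3) x(2,3)] c[OF ABC(1,3) x(1,3)] by simp
    then show "c A C = c A B + c B C"
      by (simp only: of_int_eq_iff)
  qed
  from div[OF \<U> this] obtain \<V> \<rho> d where V: "open_cover X \<V>" and \<rho>: "\<rho> \<in> refinement_maps \<U> \<V>"
    and coh: "cohomologous1 \<V> (\<lambda>A B. c (\<rho> A) (\<rho> B)) (\<lambda>A B. int n * d A B)"
    by (elim exE conjE)
  obtain e where e: "\<And>A B. \<lbrakk>A \<in> \<V>; B \<in> \<V>; A \<inter> B \<noteq> {}\<rbrakk> \<Longrightarrow> c (\<rho> A) (\<rho> B) = int n * d A B + e B - e A"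
    by (rule cohomologous1E[OF coh]) blast
  \<comment> \<open>Subtracting \<open>e\<close> changes the jump from \<open>c\<close> to
    \<open>int n * d\<close>. After division by \<open>n\<close> the branches differ by integers, so
    their exponentials agree, and the integer shift is invisible in the \<open>n\<close>-th
    power.\<close>
  define G where "G A x = cis (2 * pi * ((\<theta> (\<rho> A) x - of_int (e A)) / n))" for A x
  obtain g where g_cont: "continuous_map X euclidean g"
    and g: "\<And>x A. \<lbrakk>A \<in> \<V>; x \<in> topspace X \<inter> id A\<rbrakk> \<Longrightarrow> g x = G A x"
  proof (rule pasting_lemma_exists[where X = X and Y = euclidean and I = \<V> and T = id and f = G])
    show "topspace X \<subseteq> \<Union>(id ` \<V>)"
      using V by (simp add: open_cover_def)
    show "openin X (id A)" if "A \<in> \<V>" for A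
      using V that by (simp add: open_cover_def)
    show "continuous_map (subtopology X (id A)) euclidean (G A)" if A: "A \<in> \<V>" for A
      unfolding G_def
    proof (rule continuous_map_continuous_on_compose[where f = "\<theta> (\<rho> A)" and S = UNIV])
      show "continuous_map (subtopology X (id A)) euclideanreal (\<theta> (\<rho> A))"
        using refinement_mapsD[OF \<rho> A]
        by (intro continuous_map_from_subtopology_mono[OF \<theta>_cont]) auto
    qed (use n in \<open>auto intro!: continuous_intros\<close>)
    show "G A x = G B x" if AB: "A \<in> \<V>" "B \<in> \<V>" "x \<in> topspace X \<inter> id A \<inter> id B" for A B x
    proof -
      have "B \<inter> A \<noteq> {}"
        using AB by auto
      then have "real_of_int (int n * d B A + e A - e B) = \<theta> (\<rho> A) x - \<theta> (\<rho> B) x"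
        using e[OF AB(2,1)] c[of "\<rho> B" "\<rho> A" x] refinement_mapsD[OF \<rho>] AB by auto
      then have "(\<theta> (\<rho> A) x - of_int (e A)) / n - (\<theta> (\<rho> B) x - of_int (e B)) / n = of_int (d B A)"
        using n by (simp add: nonzero_divide_eq_eq algebra_simps flip: diff_divide_distrib)
      then show ?thesis
        unfolding G_def cis_two_pi_eq_iff by simp
    qed
  qed blast
  have "g x ^ n = f x" if x: "x \<in> topspace X" for x
  proof -
    obtain A where A: "A \<in> \<V>" "x \<in> A"
      using x V unfolding open_cover_def by blast
    then have "g x ^ n = cis (real n * (2 * pi * ((\<theta> (\<rho> A) x - of_int (e A)) / n)))"
      using g[of A x] x by (simp add: G_def Complex.DeMoivre)
    also have "\<dots> = cis (2 * pi * (\<theta> (\<rho> A) x - of_int (e A)))"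
      using n by simp
    also have "\<dots> = cis (2 * pi * \<theta> (\<rho> A) x)"
      unfolding cis_two_pi_eq_iff by simp
    also have "\<dots> = f x"
      using refinement_mapsD[OF \<rho>] A by (intro cis_\<theta>) auto
    finally show ?thesis .
  qed
  then show "\<exists>g. continuous_map X euclidean g \<and> (\<forall>x\<in>topspace X. g x ^ n = f x)"
    using g_cont by blast
qed

lemma divisible_by_cech_cohomology_iff_circle_root_closed:
  assumes "Hausdorff_space X" "paracompact_space X" "n > 0"
  shows "divisible_by n (cech_cohomology 1 X) \<longleftrightarrow> circle_root_closed n X"
  unfolding divisible_by_cech_cohomology_iff
  using circle_root_closed_imp_cocycle_divisible[OF assms] cocycle_divisible_imp_circle_root_closed[OF assms(3), of X]
  by meson

section \<open>Approximate roots\<close>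

lemma norm_le_sup_norm:
  assumes "bounded (f ` topspace X)" "x \<in> topspace X"
  shows "norm (f x) \<le> sup_norm X f"
  unfolding sup_norm_def
proof (rule cSup_upper)
  obtain b where "\<And>y. y \<in> topspace X \<Longrightarrow> norm (f y) \<le> b"
    using assms(1) unfolding bounded_iff by blast
  then show "bdd_above (insert 0 ((\<lambda>x. norm (f x)) ` topspace X))"
    by (intro bdd_aboveI[of _ "max 0 b"]) (auto simp: max.coboundedI2)
qed (use assms(2) in simp)

lemma sup_norm_le:
  assumes "0 \<le> b" "\<And>x. x \<in> topspace X \<Longrightarrow> norm (f x) \<le> b"
  shows "sup_norm X f \<le> b"
  unfolding sup_norm_def by (rule cSup_least) (use assms in auto)

lemma continuous_map_complex_of_Re_Im:
  assumes "continuous_map X euclideanreal p" "continuous_map X euclideanreal q"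
  shows "continuous_map X euclidean (\<lambda>x. Complex (p x) (q x))"
  unfolding Complex_eq
  by (intro continuous_map_add continuous_map_complex_mult
      continuous_map_continuous_on_compose[OF assms(1), where S = UNIV]
      continuous_map_continuous_on_compose[OF assms(2), where S = UNIV])
    (auto intro!: continuous_intros)

text \<open>Real and imaginary parts are extended separately, so the extension is bounded but may
  exceed \<open>b\<close> in norm.\<close>

lemma Tietze_extension_complex:
  fixes f :: "'a \<Rightarrow> complex"
  assumes X: "normal_space X" and A: "closedin X A"
    and f: "continuous_map (subtopology X A) euclidean f" and bound: "\<And>x. x \<in> A \<Longrightarrow> norm (f x) \<le> b"
  obtains F where "continuous_map X euclidean F" "\<And>x. x \<in> A \<Longrightarrow> F x = f x" "bounded (F ` topspace X)"
proof -
  \<comment> \<open>If \<open>A\<close> is empty, \<open>b\<close> may be negative, but the target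
    interval of the real extensions must be nonempty.\<close>
  define b' where "b' = max 0 b"
  have part: "\<exists>p. continuous_map X euclideanreal p \<and> (\<forall>x\<in>A. p x = \<phi> (f x)) \<and> p ` topspace X \<subseteq> {- b'..b'}"
    if \<phi>: "continuous_on UNIV \<phi>" "\<And>z. \<bar>\<phi> z\<bar> \<le> norm z" for \<phi> :: "complex \<Rightarrow> real"
  proof (rule Tietze_extension_closed_real_interval[OF X A])
    show "continuous_map (subtopology X A) euclideanreal (\<lambda>x. \<phi> (f x))"
      using \<phi>(1) by (rule continuous_map_continuous_on_compose[OF f]) simp
    show "(\<lambda>x. \<phi> (f x)) ` A \<subseteq> {- b'..b'}"
    proof
      fix y assume "y \<in> (\<lambda>x. \<phi> (f x)) ` A"
      then obtain x where "x \<in> A" "y = \<phi> (f x)"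
        by blast
      then have "\<bar>y\<bar> \<le> b'"
        using \<phi>(2)[of "f x"] bound[of x] by (simp add: b'_def)
      then show "y \<in> {- b'..b'}"
        by (simp add: abs_le_iff)
    qed
    show "- b' \<le> b'"
      by (simp add: b'_def)
  qed blast
  obtain p where p: "continuous_map X euclideanreal p" "\<forall>x\<in>A. p x = Re (f x)" "p ` topspace X \<subseteq> {- b'..b'}"
    using part[of Re] abs_Re_le_cmod continuous_on_Re[OF continuous_on_id] by auto
  obtain q where q: "continuous_map X euclideanreal q" "\<forall>x\<in>A. q x = Im (f x)" "q ` topspace X \<subseteq> {- b'..b'}"
    using part[of Im] abs_Im_le_cmod continuous_on_Im[OF continuous_on_id] by auto
  show thesis
  proof
    show "continuous_map X euclidean (\<lambda>x. Complex (p x) (q x))"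
      using p(1) q(1) by (rule continuous_map_complex_of_Re_Im)
    show "Complex (p x) (q x) = f x" if "x \<in> A" for x
      using p(2) q(2) that by simp
    have "norm (Complex (p x) (q x)) \<le> b' + b'" if "x \<in> topspace X" for x
    proof -
      have "p x \<in> {- b'..b'}" "q x \<in> {- b'..b'}"
        using p(3) q(3) that by blast+
      then have "\<bar>p x\<bar> \<le> b'" "\<bar>q x\<bar> \<le> b'"
        by (simp_all add: abs_le_iff)
      then show ?thesis
        using cmod_le[of "Complex (p x) (q x)"] by simp
    qed
    then show "bounded ((\<lambda>x. Complex (p x) (q x)) ` topspace X)"
      unfolding bounded_iff by blast
  qed
qed

lemma approximately_root_closed_imp_circle_root_closed:
  assumes X: "normal_space X" and A: "closedin X A" and n: "n > 0"
    and root: "approximately_root_closed n X"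
  shows "circle_root_closed n (subtopology X A)"
  unfolding circle_root_closed_def
proof (intro allI impI, elim conjE)
  fix f :: "'a \<Rightarrow> complex"
  assume f_cont: "continuous_map (subtopology X A) euclidean f"
    and "\<forall>x\<in>topspace (subtopology X A). norm (f x) = 1"
  then have f_norm: "norm (f x) = 1" if "x \<in> A" for x
    using that closedin_subset[OF A] by auto
  obtain F where F: "continuous_map X euclidean F" "\<And>x. x \<in> A \<Longrightarrow> F x = f x" "bounded (F ` topspace X)"
    using Tietze_extension_complex[OF X A f_cont, of 1] f_norm by (metis order_refl)
  then have "F \<in> bounded_continuous_functions X"
    by (simp add: bounded_continuous_functions_def)
  \<comment> \<open>The tolerance 1 matches the radius of the circle: the open disc of radius 1
    about 1 lies in the right half plane.\<close>
  then obtain g where g: "g \<in> bounded_continuous_functions X" and near: "sup_norm X (\<lambda>x. F x - g x ^ n) < 1"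
    using root zero_less_one unfolding approximately_root_closed_def by metis
  have g_cont: "continuous_map X euclidean g" and "bounded (g ` topspace X)"
    using g by (simp_all add: bounded_continuous_functions_def)
  then obtain b where b: "\<And>x. x \<in> topspace X \<Longrightarrow> norm (g x) \<le> b"
    unfolding bounded_iff by blast
  obtain a where a: "\<And>x. x \<in> topspace X \<Longrightarrow> norm (F x) \<le> a"
    using F(3) unfolding bounded_iff by blast
  \<comment> \<open>\<open>sup_norm\<close> controls the values only if they are bounded, the
    supremum of an unbounded set of reals being unspecified.\<close>
  have "norm (F x - g x ^ n) \<le> a + b ^ n" if x: "x \<in> topspace X" for x
  proof -
    have "norm (F x - g x ^ n) \<le> norm (F x) + norm (g x) ^ n"
      using norm_triangle_ineq4[of "F x" "g x ^ n"] by (simp add: norm_power)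
    also have "\<dots> \<le> a + b ^ n"
      using a[OF x] b[OF x] by (intro add_mono power_mono) auto
    finally show ?thesis .
  qed
  then have bdd: "bounded ((\<lambda>x. F x - g x ^ n) ` topspace X)"
    unfolding bounded_iff by blast
  have re: "0 < Re (g x ^ n / f x)" if x: "x \<in> A" for x
  proof -
    have "norm (F x - g x ^ n) < 1"
      using norm_le_sup_norm[OF bdd, of x] near closedin_subset[OF A] x by auto
    moreover have "F x - g x ^ n = f x * (1 - g x ^ n / f x)"
      using F(2)[OF x] f_norm[OF x] by (auto simp: field_simps)
    ultimately have "norm (1 - g x ^ n / f x) < 1"
      using f_norm[OF x] by (simp add: norm_mult)
    then show ?thesis
      using abs_Re_le_cmod[of "1 - g x ^ n / f x"] by simp
  qed
  \<comment> \<open>On \<open>A\<close> this is \<open>g^n / f\<close>, as \<open>f\<close> has norm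
    1 there; with conjugation in place of division, continuity has no side condition.\<close>
  define w where "w x = g x ^ n * cnj (f x)" for x
  have w: "w x = g x ^ n / f x" if "x \<in> A" for x
    using f_norm[OF that] by (simp add: w_def divide_conv_cnj)
  have g_cont': "continuous_map (subtopology X A) euclidean g"
    using g_cont by (rule continuous_map_from_subtopology)
  have "continuous_map (subtopology X A) euclidean w"
    unfolding w_def
    by (intro continuous_map_complex_mult continuous_map_continuous_on_compose[OF g_cont', where S = UNIV]
        continuous_map_continuous_on_compose[OF f_cont, where S = UNIV])
      (auto intro!: continuous_intros)
  \<comment> \<open>An inverse \<open>n\<close>-th root of \<open>w\<close>: multiplied by it,
    \<open>g\<close> has the \<open>n\<close>-th power \<open>g^n / w = f\<close>.\<close>
  then have "continuous_map (subtopology X A) euclidean (\<lambda>x. exp (- Ln (w x) / n))"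
  proof (rule continuous_map_continuous_on_compose[where S = "{z. 0 < Re z}"])
    show "continuous_on {z. 0 < Re z} (\<lambda>z. exp (- Ln z / n))"
      using n by (intro continuous_intros) (auto simp: complex_nonpos_Reals_iff)
  qed (use re w in simp)
  then have "continuous_map (subtopology X A) euclidean (\<lambda>x. g x * exp (- Ln (w x) / n))"
    by (rule continuous_map_complex_mult[OF g_cont'])
  moreover have "(g x * exp (- Ln (w x) / n)) ^ n = f x" if "x \<in> topspace (subtopology X A)" for x
  proof -
    have x: "x \<in> A"
      using that by simp
    have "g x ^ n / f x \<noteq> 0"
      using re[OF x] by (metis less_irrefl zero_complex.sel(1))
    then have nz: "w x \<noteq> 0" "f x \<noteq> 0" "g x ^ n \<noteq> 0"
      using w[OF x] by (auto simp del: power_eq_0_iff)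
    have "exp (- Ln (w x) / n) ^ n = exp (- Ln (w x))"
      using n by (simp flip: exp_of_nat_mult)
    also have "\<dots> = inverse (w x)"
      using nz(1) by (simp add: exp_minus)
    also have "\<dots> = f x / g x ^ n"
      by (simp add: w[OF x])
    finally show ?thesis
      using nz by (simp add: power_mult_distrib)
  qed
  ultimately show "\<exists>g. continuous_map (subtopology X A) euclidean g \<and>
      (\<forall>x\<in>topspace (subtopology X A). g x ^ n = f x)"
    by blast
qed

lemma circle_root_closed_imp_approximately_root_closed:
  assumes X: "normal_space X" and n: "n > 0"
    and root: "\<And>A. closedin X A \<Longrightarrow> circle_root_closed n (subtopology X A)"
  shows "approximately_root_closed n X"
  unfolding approximately_root_closed_def
proof (intro ballI allI impI)
  fix f and \<epsilon> :: real
  assume "f \<in> bounded_continuous_functions X" and \<epsilon>: "0 < \<epsilon>"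
  then have f_cont: "continuous_map X euclidean f" and "bounded (f ` topspace X)"
    by (simp_all add: bounded_continuous_functions_def)
  then obtain b where b: "\<And>x. x \<in> topspace X \<Longrightarrow> norm (f x) \<le> b"
    unfolding bounded_iff by blast
  \<comment> \<open>Off \<open>A\<close> the error is at most \<open>2 |f|\<close>, hence below
    \<open>\<epsilon> / 2\<close>. Stopping at \<open>\<epsilon> / 2\<close> keeps the inequality
    strict after the supremum is taken.\<close>
  define A where "A = {x \<in> topspace X. f x \<in> {z. \<epsilon> / 4 \<le> norm z}}"
  have A: "closedin X A"
    unfolding A_def
  proof (rule closedin_continuous_map_preimage[OF f_cont])
    have "closed {z::complex. \<epsilon> / 4 \<le> norm z}"
      by (intro closed_Collect_le continuous_intros)
    then show "closedin euclidean {z::complex. \<epsilon> / 4 \<le> norm z}"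
      by (simp only: closed_closedin)
  qed
  have "continuous_map (subtopology X A) euclidean (\<lambda>x. f x / of_real (norm (f x)))"
  proof (rule continuous_map_continuous_on_compose[where f = f and S = "- {0}"])
    show "continuous_map (subtopology X A) euclidean f"
      using f_cont by (rule continuous_map_from_subtopology)
    show "continuous_on (- {0}) (\<lambda>z::complex. z / of_real (norm z))"
      by (intro continuous_intros) auto
  qed (use \<epsilon> in \<open>auto simp: A_def\<close>)
  moreover have "norm (f x / of_real (norm (f x))) = 1" if "x \<in> topspace (subtopology X A)" for x
    using that \<epsilon> by (auto simp: A_def norm_divide)
  ultimately obtain u where u_cont: "continuous_map (subtopology X A) euclidean u"
    and "\<And>x. x \<in> topspace (subtopology X A) \<Longrightarrow> u x ^ n = f x / of_real (norm (f x))"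
    by (rule circle_root_closedE[OF root[OF A]]) (assumption | rule that)+
  then have u: "u x ^ n = f x / of_real (norm (f x))" if "x \<in> A" for x
    using that closedin_subset[OF A] by auto
  have u_norm: "norm (u x) = 1" if x: "x \<in> A" for x
  proof -
    have "norm (u x) ^ n = 1"
      using u[OF x] x \<epsilon> by (auto simp: A_def norm_divide simp flip: norm_power)
    then show ?thesis
      using power_eq_iff_eq_base[OF n norm_ge_zero, of 1 "u x"] by simp
  qed
  obtain G where G: "continuous_map X euclidean G" "\<And>x. x \<in> A \<Longrightarrow> G x = u x"
    using Tietze_extension_complex[OF X A u_cont, of 1] u_norm by (metis order_refl)
  \<comment> \<open>On \<open>A\<close> the norm of \<open>G\<close> is 1, so the quotient is
    \<open>u\<close> and \<open>g^n = f\<close>. Elsewhere the extension \<open>G\<close> may be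
    large; the maximum caps the quotient at norm 1, which gives
    \<open>|g|^n \<le> |f|\<close>.\<close>
  define g where "g x = complex_of_real (root n (norm (f x))) * (G x / of_real (max 1 (norm (G x))))" for x
  have G_le: "norm (G x / of_real (max 1 (norm (G x)))) \<le> 1" for x
    by (simp add: norm_divide)
  have g_norm: "norm (g x) \<le> root n (norm (f x))" for x
  proof -
    have "norm (g x) = root n (norm (f x)) * norm (G x / of_real (max 1 (norm (G x))))"
      unfolding g_def norm_mult by (simp add: real_root_ge_zero)
    then show ?thesis
      using mult_left_mono[OF G_le[of x], of "root n (norm (f x))"] by (simp add: real_root_ge_zero)
  qed
  have g_cont: "continuous_map X euclidean g"
    unfolding g_def
  proof (rule continuous_map_complex_mult)
    show "continuous_map X euclidean (\<lambda>x. complex_of_real (root n (norm (f x))))"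
      by (rule continuous_map_continuous_on_compose[OF f_cont, where S = UNIV])
        (auto intro!: continuous_intros)
    show "continuous_map X euclidean (\<lambda>x. G x / of_real (max 1 (norm (G x))))"
      by (rule continuous_map_continuous_on_compose[OF G(1), where S = UNIV])
        (auto intro!: continuous_intros)
  qed
  have "norm (g x) \<le> root n b" if "x \<in> topspace X" for x
    using g_norm[of x] real_root_le_mono[OF n b[OF that]] by linarith
  then have "bounded (g ` topspace X)"
    unfolding bounded_iff by blast
  then have "g \<in> bounded_continuous_functions X"
    using g_cont by (simp add: bounded_continuous_functions_def)
  moreover have "norm (f x - g x ^ n) \<le> \<epsilon> / 2" if x: "x \<in> topspace X" for x
  proof (cases "x \<in> A")
    case True
    have "g x = complex_of_real (root n (norm (f x))) * u x"
      using G(2)[OF True] u_norm[OF True] by (simp add: g_def)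
    then have "g x ^ n = complex_of_real (root n (norm (f x)) ^ n) * u x ^ n"
      by (simp add: power_mult_distrib)
    also have "\<dots> = f x"
      using n True \<epsilon> u[OF True] by (auto simp: A_def)
    finally show ?thesis
      using \<epsilon> by simp
  next
    case False
    have "norm (g x ^ n) \<le> root n (norm (f x)) ^ n"
      unfolding norm_power using g_norm by (intro power_mono) auto
    also have "\<dots> = norm (f x)"
      using n by simp
    finally have "norm (f x - g x ^ n) \<le> norm (f x) + norm (f x)"
      using norm_triangle_ineq4[of "f x" "g x ^ n"] by linarith
    then show ?thesis
      using False x by (simp add: A_def)
  qed
  then have "sup_norm X (\<lambda>x. f x - g x ^ n) \<le> \<epsilon> / 2"
    using \<epsilon> by (intro sup_norm_le) auto
  ultimately show "\<exists>g\<in>bounded_continuous_functions X. sup_norm X (\<lambda>x. f x - g x ^ n) < \<epsilon>"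
    using \<epsilon> by (intro bexI[of _ g]) auto
qed

theorem theorem4p3:
  fixes X :: "'a topology" and n :: nat
  assumes "Hausdorff_space X" and "paracompact_space X" and "n > 1"
  shows "approximately_root_closed n X \<longleftrightarrow>
           (\<forall>A. closedin X A \<longrightarrow> divisible_by n (cech_cohomology 1 (subtopology X A)))"
proof -
  have n: "n > 0"
    using assms(3) by simp
  have normal: "normal_space X"
    using assms(1,2) by (rule paracompact_Hausdorff_imp_normal_space)
  \<comment> \<open>A closed \<open>A\<close> inherits both topological assumptions, so divisibility
    and exact roots are equivalent on each \<open>A\<close> separately.\<close>
  have "divisible_by n (cech_cohomology 1 (subtopology X A)) \<longleftrightarrow> circle_root_closed n (subtopology X A)"
    if "closedin X A" for A
    using assms(1) paracompact_space_closed_subtopology[OF assms(2) that] n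
    by (intro divisible_by_cech_cohomology_iff_circle_root_closed Hausdorff_space_subtopology)
  then show ?thesis
    using approximately_root_closed_imp_circle_root_closed[OF normal _ n]
      circle_root_closed_imp_approximately_root_closed[OF normal n] by blast
qed

end
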